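(* Let $(A,\mu,\Delta,\alpha,r)$ be a quasi-triangular $\epsilon$-Hom-bialgebra. Then for each integer $n\ge 0$, $$A^n=(A,\mu^{(n)},\Delta^{(n)},\alpha^{2^n},r)$$ is also a quasi-triangular $\epsilon$-Hom-bialgebra, where $\mu^{(n)}=\alpha^{2^n-1}\circ\mu$ and $\Delta^{(n)}=\Delta\circ\alpha^{2^n-1}$.
   Context: Throughout, $\mathbf{k}$ is a fixed field of characteristic $0$; vector spaces, linear maps and tensor products are over $\mathbf{k}$. For a linear self-map $f$, $f^m$ denotes its $m$-fold composition, with $f^0=Id$. An $\epsilon$-Hom-bialgebra $(A,\mu,\Delta,\alpha)$ is a $\mathbf{k}$-vector space $A$ with linear maps $\mu\colon A^{\otimes 2}\to A$, $\Delta\colon A\to A^{\otimes 2}$, $\alpha\colon A\to A$ such that: $\alpha\circ\mu=\mu\circ\alpha^{\otimes 2}$; $\mu\circ(\alpha\otimes\mu)=\mu\circ(\mu\otimes\alpha)$; $\alpha^{\otimes 2}\circ\Delta=\Delta\circ\alpha$; $(\alpha\otimes\Delta)\circ\Delta=(\Delta\otimes\alpha)\circ\Delta$; and $\Delta\circ\mu=(\mu\otimes\alpha)\circ(\alpha\otimes\Delta)+(\alpha\otimes\mu)\circ(\Delta\otimes\alpha)$. For $a\in A$ and $r=\sum u_i\otimes v_i\in A^{\otimes 2}$, set $[a,r]_*=\sum\mu(a,u_i)\otimes\alpha(v_i)-\alpha(u_i)\otimes\mu(v_i,a)$. A coboundary $\epsilon$-Hom-bialgebra $(A,\mu,\Delta,\alpha,r)$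 is an $\epsilon$-Hom-bialgebra $(A,\mu,\Delta,\alpha)$ together with an element $r\in A^{\otimes 2}$ with $\alpha^{\otimes 2}(r)=r$ such that $\Delta=[-,r]_*$. For $r=\sum u_i\otimes v_i$, set $$A(r)=\sum_{i,j}\mu(u_i,u_j)\otimes\alpha(v_j)\otimes\alpha(v_i)-\sum_{i,j}\alpha(u_i)\otimes\mu(v_i,u_j)\otimes\alpha(v_j)+\sum_{i,j}\alpha(u_j)\otimes\alpha(u_i)\otimes\mu(v_i,v_j)\in A^{\otimes 3}.$$ A quasi-triangular $\epsilon$-Hom-bialgebra is a coboundary $\epsilon$-Hom-bialgebra $(A,\mu,\Delta,\alpha,r)$ with $A(r)=0$ (the associative Hom-Yang-Baxter equation). The expressions $[-,r]_*$ and $A(r)$ are always formed with the multiplication and twisting map of the structure in question. *)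

theory Defs
  imports "HOL-Algebra.Module" "HOL-Algebra.AbelCoset"
begin

section \<open>Linear maps and tensor products\<close>

text \<open>
  Vector spaces over a field \<open>K\<close> are modules over \<open>K\<close> in the sense of
  \<^theory>\<open>HOL-Algebra.Module\<close>. The multiplicative fields \<open>mult\<close>, \<open>one\<close> of a module record play no
  role and are left undefined in the constructions below.
\<close>

definition linear_map ::
  "('k, 'm) ring_scheme \<Rightarrow> ('k, 'a, 'p) module_scheme \<Rightarrow> ('k, 'b, 'q) module_scheme \<Rightarrow> ('a \<Rightarrow> 'b) \<Rightarrow> bool"
  where "linear_map K V W f \<longleftrightarrow>
    f \<in> carrier V \<rightarrow> carrier W \<and>
    (\<forall>x\<in>carrier V. \<forall>y\<in>carrier V. f (x \<oplus>\<^bsub>V\<^esub> y) = f x \<oplus>\<^bsub>W\<^esub> f y) \<and>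
    (\<forall>c\<in>carrier K. \<forall>x\<in>carrier V. f (c \<odot>\<^bsub>V\<^esub> x) = c \<odot>\<^bsub>W\<^esub> f x)"

definition bilinear_map ::
  "('k, 'm) ring_scheme \<Rightarrow> ('k, 'a, 'p) module_scheme \<Rightarrow> ('k, 'b, 'q) module_scheme
    \<Rightarrow> ('k, 'c, 'r) module_scheme \<Rightarrow> ('a \<Rightarrow> 'b \<Rightarrow> 'c) \<Rightarrow> bool"
  where "bilinear_map K V W U f \<longleftrightarrow>
    (\<forall>x\<in>carrier V. linear_map K W U (f x)) \<and>
    (\<forall>y\<in>carrier W. linear_map K V U (\<lambda>x. f x y))"

text \<open>The free module on a set \<open>S\<close>: finitely supported families of scalars, supported in \<open>S\<close>.\<close>

definition free_module :: "('k, 'm) ring_scheme \<Rightarrow> 's set \<Rightarrow> ('k, 's \<Rightarrow> 'k) module"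
  where "free_module K S =
    \<lparr>carrier = {g. (\<forall>s. g s \<in> carrier K) \<and> finite {s. g s \<noteq> \<zero>\<^bsub>K\<^esub>} \<and> (\<forall>s. s \<notin> S \<longrightarrow> g s = \<zero>\<^bsub>K\<^esub>)},
     mult = undefined, one = undefined,
     zero = (\<lambda>s. \<zero>\<^bsub>K\<^esub>), add = (\<lambda>g h s. g s \<oplus>\<^bsub>K\<^esub> h s),
     smult = (\<lambda>c g s. c \<otimes>\<^bsub>K\<^esub> g s)\<rparr>"

definition free_gen :: "('k, 'm) ring_scheme \<Rightarrow> 's \<Rightarrow> 's \<Rightarrow> 'k"
  where "free_gen K s = (\<lambda>t. if t = s then \<one>\<^bsub>K\<^esub> else \<zero>\<^bsub>K\<^esub>)"

text \<open>The linear extension of \<open>f\<close> from the basis to the free module.\<close>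

definition free_extend ::
  "('k, 'm) ring_scheme \<Rightarrow> ('k, 'c, 'r) module_scheme \<Rightarrow> ('s \<Rightarrow> 'c) \<Rightarrow> ('s \<Rightarrow> 'k) \<Rightarrow> 'c"
  where "free_extend K U f g = (\<Oplus>\<^bsub>U\<^esub> p \<in> {p. g p \<noteq> \<zero>\<^bsub>K\<^esub>}. g p \<odot>\<^bsub>U\<^esub> f p)"

definition submodule_span ::
  "('k, 'm) ring_scheme \<Rightarrow> ('k, 'a, 'p) module_scheme \<Rightarrow> 'a set \<Rightarrow> 'a set"
  where "submodule_span K M X = \<Inter>{N. submodule N K M \<and> X \<subseteq> N}"

definition quotient_module ::
  "('k, 'm) ring_scheme \<Rightarrow> ('k, 'a, 'p) module_scheme \<Rightarrow> 'a set \<Rightarrow> ('k, 'a set) module"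
  where "quotient_module K M N =
    \<lparr>carrier = a_rcosets\<^bsub>M\<^esub> N, mult = undefined, one = undefined,
     zero = N, add = set_add M,
     smult = (\<lambda>c X. \<Union>x\<in>X. N +>\<^bsub>M\<^esub> (c \<odot>\<^bsub>M\<^esub> x))\<rparr>"

definition tensor_rels ::
  "('k, 'm) ring_scheme \<Rightarrow> ('k, 'a, 'p) module_scheme \<Rightarrow> ('k, 'b, 'q) module_scheme \<Rightarrow> ('a \<times> 'b \<Rightarrow> 'k) set"
  where "tensor_rels K V W = (let F = free_module K (carrier V \<times> carrier W); e = free_gen K in
      {e (x \<oplus>\<^bsub>V\<^esub> x', y) \<ominus>\<^bsub>F\<^esub> (e (x, y) \<oplus>\<^bsub>F\<^esub> e (x', y)) | x x' y.
         x \<in> carrier V \<and> x' \<in> carrier V \<and> y \<in> carrier W}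
    \<union> {e (x, y \<oplus>\<^bsub>W\<^esub> y') \<ominus>\<^bsub>F\<^esub> (e (x, y) \<oplus>\<^bsub>F\<^esub> e (x, y')) | x y y'.
         x \<in> carrier V \<and> y \<in> carrier W \<and> y' \<in> carrier W}
    \<union> {e (c \<odot>\<^bsub>V\<^esub> x, y) \<ominus>\<^bsub>F\<^esub> (c \<odot>\<^bsub>F\<^esub> e (x, y)) | c x y.
         c \<in> carrier K \<and> x \<in> carrier V \<and> y \<in> carrier W}
    \<union> {e (x, c \<odot>\<^bsub>W\<^esub> y) \<ominus>\<^bsub>F\<^esub> (c \<odot>\<^bsub>F\<^esub> e (x, y)) | c x y.
         c \<in> carrier K \<and> x \<in> carrier V \<and> y \<in> carrier W})"

definition tensor_null ::
  "('k, 'm) ring_scheme \<Rightarrow> ('k, 'a, 'p) module_scheme \<Rightarrow> ('k, 'b, 'q) module_scheme \<Rightarrow> ('a \<times> 'b \<Rightarrow> 'k) set"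
  where "tensor_null K V W =
    submodule_span K (free_module K (carrier V \<times> carrier W)) (tensor_rels K V W)"

definition tensor ::
  "('k, 'm) ring_scheme \<Rightarrow> ('k, 'a, 'p) module_scheme \<Rightarrow> ('k, 'b, 'q) module_scheme
    \<Rightarrow> ('k, ('a \<times> 'b \<Rightarrow> 'k) set) module"
  where "tensor K V W =
    quotient_module K (free_module K (carrier V \<times> carrier W)) (tensor_null K V W)"

definition tensor_pure ::
  "('k, 'm) ring_scheme \<Rightarrow> ('k, 'a, 'p) module_scheme \<Rightarrow> ('k, 'b, 'q) module_scheme
    \<Rightarrow> 'a \<Rightarrow> 'b \<Rightarrow> ('a \<times> 'b \<Rightarrow> 'k) set"
  where "tensor_pure K V W x y =
    tensor_null K V W +>\<^bsub>free_module K (carrier V \<times> carrier W)\<^esub> free_gen K (x, y)"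

text \<open>
  \<open>tensor_lift K U f\<close> is the linear map \<open>V \<otimes> W \<rightarrow> U\<close> induced by a bilinear map \<open>f\<close>: an element
  \<open>t = \<Sum>\<^sub>i c\<^sub>i (u\<^sub>i \<otimes> v\<^sub>i)\<close> is sent to \<open>\<Sum>\<^sub>i c\<^sub>i f(u\<^sub>i, v\<^sub>i)\<close>. The chosen representative is irrelevant;
  see the lemmas \<open>tensor_lift_linear\<close>, \<open>tensor_lift_pure\<close> and \<open>tensor_linear_eqI\<close>, which
  together give the universal property of \<open>tensor\<close>.
\<close>

definition tensor_lift ::
  "('k, 'm) ring_scheme \<Rightarrow> ('k, 'c, 'r) module_scheme \<Rightarrow> ('a \<Rightarrow> 'b \<Rightarrow> 'c) \<Rightarrow> ('a \<times> 'b \<Rightarrow> 'k) set \<Rightarrow> 'c"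
  where "tensor_lift K U f t = free_extend K U (\<lambda>p. f (fst p) (snd p)) (SOME g. g \<in> t)"

text \<open>The tensor product \<open>f \<otimes> g\<close> of linear maps, with values in \<open>V' \<otimes> W'\<close>.\<close>

definition tensor_map ::
  "('k, 'm) ring_scheme \<Rightarrow> ('k, 'c, 'p) module_scheme \<Rightarrow> ('k, 'd, 'q) module_scheme
    \<Rightarrow> ('a \<Rightarrow> 'c) \<Rightarrow> ('b \<Rightarrow> 'd) \<Rightarrow> ('a \<times> 'b \<Rightarrow> 'k) set \<Rightarrow> ('c \<times> 'd \<Rightarrow> 'k) set"
  where "tensor_map K V' W' f g =
    tensor_lift K (tensor K V' W') (\<lambda>x y. tensor_pure K V' W' (f x) (g y))"

text \<open>The canonical map \<open>U \<otimes> (V \<otimes> W) \<rightarrow> (U \<otimes> V) \<otimes> W\<close> and its inverse.\<close>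

definition tensor_assoc ::
  "('k, 'm) ring_scheme \<Rightarrow> ('k, 'a, 'p) module_scheme \<Rightarrow> ('k, 'b, 'q) module_scheme
    \<Rightarrow> ('k, 'c, 'r) module_scheme
    \<Rightarrow> ('a \<times> ('b \<times> 'c \<Rightarrow> 'k) set \<Rightarrow> 'k) set \<Rightarrow> (('a \<times> 'b \<Rightarrow> 'k) set \<times> 'c \<Rightarrow> 'k) set"
  where "tensor_assoc K U V W =
    (let T = tensor K (tensor K U V) W in
     tensor_lift K T (\<lambda>x. tensor_lift K T (\<lambda>y z.
       tensor_pure K (tensor K U V) W (tensor_pure K U V x y) z)))"

definition tensor_assoc_inv ::
  "('k, 'm) ring_scheme \<Rightarrow> ('k, 'a, 'p) module_scheme \<Rightarrow> ('k, 'b, 'q) module_scheme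
    \<Rightarrow> ('k, 'c, 'r) module_scheme
    \<Rightarrow> (('a \<times> 'b \<Rightarrow> 'k) set \<times> 'c \<Rightarrow> 'k) set \<Rightarrow> ('a \<times> ('b \<times> 'c \<Rightarrow> 'k) set \<Rightarrow> 'k) set"
  where "tensor_assoc_inv K U V W =
    (let T = tensor K U (tensor K V W) in
     tensor_lift K T (\<lambda>t z. tensor_lift K T (\<lambda>x y.
       tensor_pure K U (tensor K V W) x (tensor_pure K V W y z)) t))"


subsection \<open>Universal property\<close>

lemma free_module_simps:
  "g \<in> carrier (free_module K S) \<longleftrightarrow>
    (\<forall>s. g s \<in> carrier K) \<and> finite {s. g s \<noteq> \<zero>\<^bsub>K\<^esub>} \<and> (\<forall>s. s \<notin> S \<longrightarrow> g s = \<zero>\<^bsub>K\<^esub>)"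
  "\<zero>\<^bsub>free_module K S\<^esub> = (\<lambda>s. \<zero>\<^bsub>K\<^esub>)"
  "g \<oplus>\<^bsub>free_module K S\<^esub> h = (\<lambda>s. g s \<oplus>\<^bsub>K\<^esub> h s)"
  "c \<odot>\<^bsub>free_module K S\<^esub> g = (\<lambda>s. c \<otimes>\<^bsub>K\<^esub> g s)"
  by (simp_all add: free_module_def)

lemma free_module_module:
  assumes "cring K"
  shows "module K (free_module K S)"
proof -
  interpret K: cring K by fact
  have sup: "finite {s. f s \<noteq> \<zero>\<^bsub>K\<^esub>}" if "finite {s. g s \<noteq> \<zero>\<^bsub>K\<^esub>}" "finite {s. h s \<noteq> \<zero>\<^bsub>K\<^esub>}"
    "\<And>s. g s = \<zero>\<^bsub>K\<^esub> \<Longrightarrow> h s = \<zero>\<^bsub>K\<^esub> \<Longrightarrow> f s = \<zero>\<^bsub>K\<^esub>" for f g h :: "'c \<Rightarrow> 'a"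
    by (rule finite_subset[OF _ finite_UnI[OF that(1,2)]]) (use that(3) in auto)
  have sup1: "finite {s. f s \<noteq> \<zero>\<^bsub>K\<^esub>}" if "finite {s. g s \<noteq> \<zero>\<^bsub>K\<^esub>}"
    "\<And>s. g s = \<zero>\<^bsub>K\<^esub> \<Longrightarrow> f s = \<zero>\<^bsub>K\<^esub>" for f g :: "'c \<Rightarrow> 'a"
    by (rule sup[OF that(1) that(1)]) (use that(2) in auto)
  show ?thesis
  proof (rule moduleI)
    show "abelian_group (free_module K S)"
    proof (rule abelian_groupI)
      fix x y assume xy: "x \<in> carrier (free_module K S)" "y \<in> carrier (free_module K S)"
      have "finite {s. x s \<oplus>\<^bsub>K\<^esub> y s \<noteq> \<zero>\<^bsub>K\<^esub>}"
        by (rule sup[of x y]) (use xy in \<open>auto simp: free_module_simps\<close>)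
      with xy show "x \<oplus>\<^bsub>free_module K S\<^esub> y \<in> carrier (free_module K S)"
        by (auto simp: free_module_simps)
    next
      fix x assume x: "x \<in> carrier (free_module K S)"
      have "finite {s. \<ominus>\<^bsub>K\<^esub> x s \<noteq> \<zero>\<^bsub>K\<^esub>}"
        by (rule sup1[of x]) (use x in \<open>auto simp: free_module_simps\<close>)
      with x have "(\<lambda>s. \<ominus>\<^bsub>K\<^esub> x s) \<in> carrier (free_module K S)"
        by (auto simp: free_module_simps)
      moreover have "(\<lambda>s. \<ominus>\<^bsub>K\<^esub> x s) \<oplus>\<^bsub>free_module K S\<^esub> x = \<zero>\<^bsub>free_module K S\<^esub>"
        using x by (auto simp: free_module_simps K.l_neg)
      ultimately show "\<exists>y\<in>carrier (free_module K S). y \<oplus>\<^bsub>free_module K S\<^esub> x = \<zero>\<^bsub>free_module K S\<^esub>"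
        by blast
    qed (auto simp: free_module_simps K.a_ac)
    fix a x assume ax: "a \<in> carrier K" "x \<in> carrier (free_module K S)"
    have "finite {s. a \<otimes>\<^bsub>K\<^esub> x s \<noteq> \<zero>\<^bsub>K\<^esub>}"
      by (rule sup1[of x]) (use ax in \<open>auto simp: free_module_simps\<close>)
    with ax show "a \<odot>\<^bsub>free_module K S\<^esub> x \<in> carrier (free_module K S)"
      by (auto simp: free_module_simps)
  qed (auto simp: free_module_simps K.l_distr K.r_distr K.m_assoc assms)
qed

lemma free_gen_closed:
  assumes "cring K" "s \<in> S"
  shows "free_gen K s \<in> carrier (free_module K S)"
proof -
  interpret K: cring K by fact
  have "finite {t. free_gen K s t \<noteq> \<zero>\<^bsub>K\<^esub>}"
    by (rule finite_subset[of _ "{s}"]) (auto simp: free_gen_def)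
  then show ?thesis using assms by (auto simp: free_module_simps free_gen_def)
qed

lemma submodule_span_submodule:
  assumes "module K M" "X \<subseteq> carrier M"
  shows "submodule (submodule_span K M X) K M"
proof -
  interpret M: module K M by fact
  have submodule_zero: "\<zero>\<^bsub>M\<^esub> \<in> N" if "submodule N K M" for N
    using subgroup.one_closed[OF submodule.axioms(1)[OF that]] by simp
  have "carrier M \<in> {N. submodule N K M \<and> X \<subseteq> N}"
    using M.carrier_is_submodule assms(2) by auto
  then show ?thesis
    unfolding submodule_span_def
  proof (intro M.submoduleI)
    assume "carrier M \<in> {N. submodule N K M \<and> X \<subseteq> N}"
    then show "\<Inter>{N. submodule N K M \<and> X \<subseteq> N} \<subseteq> carrier M" by (rule Inter_lower)
  qed (simp_all add: submodule_zero M.submoduleE)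
qed

lemma submodule_span_superset: "X \<subseteq> submodule_span K M X"
  by (auto simp: submodule_span_def)

lemma submodule_span_minimal:
  "submodule N K M \<Longrightarrow> X \<subseteq> N \<Longrightarrow> submodule_span K M X \<subseteq> N"
  by (auto simp: submodule_span_def)

lemma submodule_abelian_subgroup:
  assumes "module K M" "submodule N K M"
  shows "abelian_subgroup N M"
proof -
  interpret M: module K M by fact
  show ?thesis
    using submodule.axioms(1)[OF assms(2)] M.a_comm_group by (rule abelian_subgroupI2[rotated])
qed

lemma quotient_module_simps:
  assumes "module K M" "submodule N K M"
  shows "carrier (quotient_module K M N) = (\<lambda>x. N +>\<^bsub>M\<^esub> x) ` carrier M"
    "\<zero>\<^bsub>quotient_module K M N\<^esub> = N +>\<^bsub>M\<^esub> \<zero>\<^bsub>M\<^esub>"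
    "x \<in> carrier M \<Longrightarrow> y \<in> carrier M \<Longrightarrow>
      (N +>\<^bsub>M\<^esub> x) \<oplus>\<^bsub>quotient_module K M N\<^esub> (N +>\<^bsub>M\<^esub> y) = N +>\<^bsub>M\<^esub> (x \<oplus>\<^bsub>M\<^esub> y)"
    "c \<in> carrier K \<Longrightarrow> x \<in> carrier M \<Longrightarrow>
      c \<odot>\<^bsub>quotient_module K M N\<^esub> (N +>\<^bsub>M\<^esub> x) = N +>\<^bsub>M\<^esub> (c \<odot>\<^bsub>M\<^esub> x)"
proof -
  interpret M: module K M by fact
  interpret N: abelian_subgroup N M by (rule submodule_abelian_subgroup[OF assms])
  show "carrier (quotient_module K M N) = (\<lambda>x. N +>\<^bsub>M\<^esub> x) ` carrier M"
    by (auto simp: quotient_module_def A_RCOSETS_def RCOSETS_def a_r_coset_def)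
  show "\<zero>\<^bsub>quotient_module K M N\<^esub> = N +>\<^bsub>M\<^esub> \<zero>\<^bsub>M\<^esub>"
    by (simp add: quotient_module_def M.a_coset_add_zero[OF N.a_subset])
  show "(N +>\<^bsub>M\<^esub> x) \<oplus>\<^bsub>quotient_module K M N\<^esub> (N +>\<^bsub>M\<^esub> y) = N +>\<^bsub>M\<^esub> (x \<oplus>\<^bsub>M\<^esub> y)"
    if "x \<in> carrier M" "y \<in> carrier M"
    using that by (simp add: quotient_module_def N.a_rcos_sum)
  show "c \<odot>\<^bsub>quotient_module K M N\<^esub> (N +>\<^bsub>M\<^esub> x) = N +>\<^bsub>M\<^esub> (c \<odot>\<^bsub>M\<^esub> x)"
    if c: "c \<in> carrier K" and x: "x \<in> carrier M"
  proof -
    have "N +>\<^bsub>M\<^esub> (c \<odot>\<^bsub>M\<^esub> y) = N +>\<^bsub>M\<^esub> (c \<odot>\<^bsub>M\<^esub> x)" if "y \<in> N +>\<^bsub>M\<^esub> x" for y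
    proof -
      from that obtain h where h: "h \<in> N" "y = h \<oplus>\<^bsub>M\<^esub> x"
        by (auto simp: a_r_coset_def r_coset_def)
      then have "c \<odot>\<^bsub>M\<^esub> y = c \<odot>\<^bsub>M\<^esub> h \<oplus>\<^bsub>M\<^esub> c \<odot>\<^bsub>M\<^esub> x"
        using c x by (simp add: M.smult_r_distr)
      then have "c \<odot>\<^bsub>M\<^esub> y \<in> N +>\<^bsub>M\<^esub> (c \<odot>\<^bsub>M\<^esub> x)"
        using submodule.smult_closed[OF assms(2) c h(1)] by (auto simp: a_r_coset_def r_coset_def)
      then show ?thesis
        using c x N.a_repr_independence' by simp
    qed
    then have "\<forall>y \<in> N +>\<^bsub>M\<^esub> x. N +>\<^bsub>M\<^esub> (c \<odot>\<^bsub>M\<^esub> y) = N +>\<^bsub>M\<^esub> (c \<odot>\<^bsub>M\<^esub> x)" by (rule ballI)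
    from UN_constant_eq[OF N.a_rcos_self[OF x] this] show ?thesis
      by (simp only: quotient_module_def module.simps)
  qed
qed

lemma quotient_module_module:
  assumes "module K M" "submodule N K M"
  shows "module K (quotient_module K M N)"
proof -
  interpret M: module K M by fact
  let ?Q = "quotient_module K M N"
  note simps = quotient_module_simps[OF assms]
  have rep: "\<exists>x\<in>carrier M. X = N +>\<^bsub>M\<^esub> x" if "X \<in> carrier ?Q" for X
    using that by (auto simp: simps(1))
  have cl: "N +>\<^bsub>M\<^esub> x \<in> carrier ?Q" if "x \<in> carrier M" for x
    using that by (simp add: simps(1))
  show ?thesis
  proof (rule moduleI)
    show "cring K" by (rule M.R.cring_axioms)
    show "abelian_group ?Q"
    proof (rule abelian_groupI)
      fix X Y Z assume "X \<in> carrier ?Q" "Y \<in> carrier ?Q" "Z \<in> carrier ?Q"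
      then obtain x y z where xyz: "x \<in> carrier M" "y \<in> carrier M" "z \<in> carrier M"
        and eq: "X = N +>\<^bsub>M\<^esub> x" "Y = N +>\<^bsub>M\<^esub> y" "Z = N +>\<^bsub>M\<^esub> z" using rep by metis
      show "X \<oplus>\<^bsub>?Q\<^esub> Y \<oplus>\<^bsub>?Q\<^esub> Z = X \<oplus>\<^bsub>?Q\<^esub> (Y \<oplus>\<^bsub>?Q\<^esub> Z)"
        using xyz by (simp add: eq simps(3) M.a_assoc)
    next
      fix X Y assume "X \<in> carrier ?Q" "Y \<in> carrier ?Q"
      then obtain x y where xy: "x \<in> carrier M" "y \<in> carrier M"
        and eq: "X = N +>\<^bsub>M\<^esub> x" "Y = N +>\<^bsub>M\<^esub> y" using rep by metis
      show "X \<oplus>\<^bsub>?Q\<^esub> Y \<in> carrier ?Q" using xy by (simp add: eq simps(3) cl)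
      show "X \<oplus>\<^bsub>?Q\<^esub> Y = Y \<oplus>\<^bsub>?Q\<^esub> X" using xy by (simp add: eq simps(3) M.a_comm)
    next
      show "\<zero>\<^bsub>?Q\<^esub> \<in> carrier ?Q" by (simp add: simps(2) cl)
    next
      fix X assume "X \<in> carrier ?Q"
      then obtain x where x: "x \<in> carrier M" and eq: "X = N +>\<^bsub>M\<^esub> x" using rep by metis
      show "\<zero>\<^bsub>?Q\<^esub> \<oplus>\<^bsub>?Q\<^esub> X = X" using x by (simp add: eq simps(2,3))
      have "(N +>\<^bsub>M\<^esub> (\<ominus>\<^bsub>M\<^esub> x)) \<oplus>\<^bsub>?Q\<^esub> X = \<zero>\<^bsub>?Q\<^esub>"
        using x by (simp add: eq simps(2,3) M.l_neg)
      then show "\<exists>Y\<in>carrier ?Q. Y \<oplus>\<^bsub>?Q\<^esub> X = \<zero>\<^bsub>?Q\<^esub>"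
        using cl[of "\<ominus>\<^bsub>M\<^esub> x"] x by auto
    qed
  next
    fix a b X assume ab: "a \<in> carrier K" "b \<in> carrier K" and "X \<in> carrier ?Q"
    then obtain x where x: "x \<in> carrier M" and eq: "X = N +>\<^bsub>M\<^esub> x" using rep by metis
    show "(a \<oplus>\<^bsub>K\<^esub> b) \<odot>\<^bsub>?Q\<^esub> X = a \<odot>\<^bsub>?Q\<^esub> X \<oplus>\<^bsub>?Q\<^esub> b \<odot>\<^bsub>?Q\<^esub> X"
      using x ab by (simp add: eq simps(3,4) M.smult_l_distr)
    show "(a \<otimes>\<^bsub>K\<^esub> b) \<odot>\<^bsub>?Q\<^esub> X = a \<odot>\<^bsub>?Q\<^esub> (b \<odot>\<^bsub>?Q\<^esub> X)"
      using x ab by (simp add: eq simps(3,4) M.smult_assoc1)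
  next
    fix a X assume a: "a \<in> carrier K" and "X \<in> carrier ?Q"
    then obtain x where x: "x \<in> carrier M" and eq: "X = N +>\<^bsub>M\<^esub> x" using rep by metis
    show "a \<odot>\<^bsub>?Q\<^esub> X \<in> carrier ?Q" using x a by (simp add: eq simps(4) cl)
  next
    fix X assume "X \<in> carrier ?Q"
    then obtain x where x: "x \<in> carrier M" and eq: "X = N +>\<^bsub>M\<^esub> x" using rep by metis
    show "\<one>\<^bsub>K\<^esub> \<odot>\<^bsub>?Q\<^esub> X = X" using x by (simp add: eq simps(4))
  next
    fix a X Y assume a: "a \<in> carrier K" and "X \<in> carrier ?Q" "Y \<in> carrier ?Q"
    then obtain x y where xy: "x \<in> carrier M" "y \<in> carrier M"
      and eq: "X = N +>\<^bsub>M\<^esub> x" "Y = N +>\<^bsub>M\<^esub> y" using rep by metis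
    show "a \<odot>\<^bsub>?Q\<^esub> (X \<oplus>\<^bsub>?Q\<^esub> Y) = a \<odot>\<^bsub>?Q\<^esub> X \<oplus>\<^bsub>?Q\<^esub> a \<odot>\<^bsub>?Q\<^esub> Y"
      using xy a by (simp add: eq simps(3,4) M.smult_r_distr)
  qed
qed

lemma free_module_induct [consumes 2, case_names zero add]:
  assumes K: "cring K" and g: "g \<in> carrier (free_module K S)"
    and zero: "P \<zero>\<^bsub>free_module K S\<^esub>"
    and add: "\<And>c s h. c \<in> carrier K \<Longrightarrow> s \<in> S \<Longrightarrow> h \<in> carrier (free_module K S) \<Longrightarrow> P h \<Longrightarrow>
      P ((c \<odot>\<^bsub>free_module K S\<^esub> free_gen K s) \<oplus>\<^bsub>free_module K S\<^esub> h)"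
  shows "P g"
proof -
  interpret K: cring K by fact
  have "finite {s. g s \<noteq> \<zero>\<^bsub>K\<^esub>}" using g by (simp add: free_module_simps)
  then show "P g" using g
  proof (induction "{s. g s \<noteq> \<zero>\<^bsub>K\<^esub>}" arbitrary: g rule: finite_induct)
    case empty
    then have "g = \<zero>\<^bsub>free_module K S\<^esub>" by (auto simp: free_module_simps)
    with zero show ?case by simp
  next
    case (insert s T)
    have sT: "{t. g t \<noteq> \<zero>\<^bsub>K\<^esub>} = Set.insert s T" using insert.hyps(4) by simp
    have gs: "g t \<in> carrier K" for t using insert.prems by (simp add: free_module_simps)
    have sS: "s \<in> S" using sT insert.prems by (auto simp: free_module_simps)
    define h where "h = g(s := \<zero>\<^bsub>K\<^esub>)"
    have hT: "T = {t. h t \<noteq> \<zero>\<^bsub>K\<^esub>}" using sT insert.hyps(2) by (auto simp: h_def)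
    have h: "h \<in> carrier (free_module K S)"
      using insert.prems insert.hyps(1) hT by (auto simp: free_module_simps h_def)
    have "g = (g s \<odot>\<^bsub>free_module K S\<^esub> free_gen K s) \<oplus>\<^bsub>free_module K S\<^esub> h"
      using gs by (auto simp: free_module_simps h_def free_gen_def)
    moreover have "P \<dots>" by (rule add[OF gs sS h insert.hyps(3)[OF hT h]])
    ultimately show ?case by simp
  qed
qed

lemma free_extend_superset:
  assumes "module K U" "g \<in> carrier (free_module K S)" "f \<in> S \<rightarrow> carrier U"
    and "finite T" "T \<subseteq> S" "{p. g p \<noteq> \<zero>\<^bsub>K\<^esub>} \<subseteq> T"
  shows "free_extend K U f g = (\<Oplus>\<^bsub>U\<^esub> p \<in> T. g p \<odot>\<^bsub>U\<^esub> f p)"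
proof -
  interpret U: module K U by fact
  have f: "f p \<in> carrier U" if "p \<in> T" for p
    using funcset_mem[OF assms(3)] assms(5) that by blast
  have g: "g p \<in> carrier K" for p using assms(2) by (simp add: free_module_simps)
  show ?thesis unfolding free_extend_def
    by (rule U.add.finprod_mono_neutral_cong_left) (use assms(4,6) f g in auto)
qed

lemma free_extend_linear:
  assumes "module K U" and f: "f \<in> S \<rightarrow> carrier U"
  shows "linear_map K (free_module K S) U (free_extend K U f)"
proof -
  interpret U: module K U by fact
  let ?F = "free_module K S" and ?e = "free_extend K U f"
  interpret F: module K ?F by (rule free_module_module[OF U.R.cring_axioms])
  have fin: "finite {p. g p \<noteq> \<zero>\<^bsub>K\<^esub>}" "{p. g p \<noteq> \<zero>\<^bsub>K\<^esub>} \<subseteq> S" "g p \<in> carrier K"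
    if "g \<in> carrier ?F" for g p using that by (auto simp: free_module_simps)
  have e: "?e g = (\<Oplus>\<^bsub>U\<^esub> p \<in> T. g p \<odot>\<^bsub>U\<^esub> f p)"
    if "g \<in> carrier ?F" "finite T" "T \<subseteq> S" "{p. g p \<noteq> \<zero>\<^bsub>K\<^esub>} \<subseteq> T" for g T
    by (rule free_extend_superset[OF U.module_axioms that(1) f that(2-)])
  have cl: "(\<lambda>p. g p \<odot>\<^bsub>U\<^esub> f p) \<in> T \<rightarrow> carrier U" if "g \<in> carrier ?F" "T \<subseteq> S" for g T
    using funcset_mem[OF f] fin(3)[OF that(1)] that(2) by (auto intro!: U.smult_closed)
  show ?thesis unfolding linear_map_def
  proof (intro conjI ballI)
    show "?e \<in> carrier ?F \<rightarrow> carrier U"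
      unfolding free_extend_def using cl fin(2) by (auto intro!: U.finsum_closed)
  next
    fix g h assume gh: "g \<in> carrier ?F" "h \<in> carrier ?F"
    let ?T = "{p. g p \<noteq> \<zero>\<^bsub>K\<^esub>} \<union> {p. h p \<noteq> \<zero>\<^bsub>K\<^esub>}"
    have T: "finite ?T" "?T \<subseteq> S" using fin gh by auto
    have sub: "{p. (g \<oplus>\<^bsub>?F\<^esub> h) p \<noteq> \<zero>\<^bsub>K\<^esub>} \<subseteq> ?T" by (auto simp: free_module_simps)
    have "?e (g \<oplus>\<^bsub>?F\<^esub> h) = (\<Oplus>\<^bsub>U\<^esub> p \<in> ?T. (g \<oplus>\<^bsub>?F\<^esub> h) p \<odot>\<^bsub>U\<^esub> f p)"
      by (rule e[OF _ T sub]) (use gh in simp)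
    also have "\<dots> = (\<Oplus>\<^bsub>U\<^esub> p \<in> ?T. (g p \<odot>\<^bsub>U\<^esub> f p) \<oplus>\<^bsub>U\<^esub> (h p \<odot>\<^bsub>U\<^esub> f p))"
    proof (rule U.finsum_cong')
      fix p assume "p \<in> ?T"
      then have "f p \<in> carrier U" using T f by blast
      then show "(g \<oplus>\<^bsub>?F\<^esub> h) p \<odot>\<^bsub>U\<^esub> f p = (g p \<odot>\<^bsub>U\<^esub> f p) \<oplus>\<^bsub>U\<^esub> (h p \<odot>\<^bsub>U\<^esub> f p)"
        using gh fin(3) by (simp add: free_module_simps(3) U.smult_l_distr)
    qed (use cl[OF gh(1) T(2)] cl[OF gh(2) T(2)] in auto)
    also have "\<dots> = (\<Oplus>\<^bsub>U\<^esub> p \<in> ?T. g p \<odot>\<^bsub>U\<^esub> f p) \<oplus>\<^bsub>U\<^esub> (\<Oplus>\<^bsub>U\<^esub> p \<in> ?T. h p \<odot>\<^bsub>U\<^esub> f p)"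
      by (rule U.finsum_addf) (use cl[OF gh(1) T(2)] cl[OF gh(2) T(2)] in auto)
    also have "(\<Oplus>\<^bsub>U\<^esub> p \<in> ?T. g p \<odot>\<^bsub>U\<^esub> f p) = ?e g" by (rule e[symmetric, OF gh(1) T]) auto
    also have "(\<Oplus>\<^bsub>U\<^esub> p \<in> ?T. h p \<odot>\<^bsub>U\<^esub> f p) = ?e h" by (rule e[symmetric, OF gh(2) T]) auto
    finally show "?e (g \<oplus>\<^bsub>?F\<^esub> h) = ?e g \<oplus>\<^bsub>U\<^esub> ?e h" .
  next
    fix c g assume c: "c \<in> carrier K" and g: "g \<in> carrier ?F"
    let ?T = "{p. g p \<noteq> \<zero>\<^bsub>K\<^esub>}"
    have T: "finite ?T" "?T \<subseteq> S" using fin g by auto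
    have sub: "{p. (c \<odot>\<^bsub>?F\<^esub> g) p \<noteq> \<zero>\<^bsub>K\<^esub>} \<subseteq> ?T" using c by (auto simp: free_module_simps)
    have "?e (c \<odot>\<^bsub>?F\<^esub> g) = (\<Oplus>\<^bsub>U\<^esub> p \<in> ?T. (c \<odot>\<^bsub>?F\<^esub> g) p \<odot>\<^bsub>U\<^esub> f p)"
      by (rule e[OF _ T sub]) (use c g in simp)
    also have "\<dots> = (\<Oplus>\<^bsub>U\<^esub> p \<in> ?T. c \<odot>\<^bsub>U\<^esub> (g p \<odot>\<^bsub>U\<^esub> f p))"
    proof (rule U.finsum_cong')
      fix p assume "p \<in> ?T"
      then have "f p \<in> carrier U" using T f by blast
      then show "(c \<odot>\<^bsub>?F\<^esub> g) p \<odot>\<^bsub>U\<^esub> f p = c \<odot>\<^bsub>U\<^esub> (g p \<odot>\<^bsub>U\<^esub> f p)"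
        using c g fin(3) by (simp add: free_module_simps(4) U.smult_assoc1)
    qed (use c cl[OF g T(2)] in auto)
    also have "\<dots> = c \<odot>\<^bsub>U\<^esub> ?e g"
      unfolding free_extend_def by (rule U.finsum_smult_ldistr[symmetric, OF T(1) c cl[OF g T(2)]])
    finally show "?e (c \<odot>\<^bsub>?F\<^esub> g) = c \<odot>\<^bsub>U\<^esub> ?e g" .
  qed
qed

lemma free_extend_gen:
  assumes "module K U" "s \<in> S" "f \<in> S \<rightarrow> carrier U"
  shows "free_extend K U f (free_gen K s) = f s"
proof -
  interpret U: module K U by fact
  have f: "f s \<in> carrier U" using assms by auto
  have "free_extend K U f (free_gen K s) = (\<Oplus>\<^bsub>U\<^esub> p \<in> {s}. free_gen K s p \<odot>\<^bsub>U\<^esub> f p)"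
    by (rule free_extend_superset[OF assms(1) free_gen_closed assms(3)])
       (use assms(2) U.R.cring_axioms in \<open>auto simp: free_gen_def\<close>)
  then show ?thesis using f by (simp add: free_gen_def)
qed

lemma linear_map_zero:
  assumes "module K V" "module K W" "linear_map K V W f"
  shows "f \<zero>\<^bsub>V\<^esub> = \<zero>\<^bsub>W\<^esub>"
proof -
  interpret V: module K V by fact
  interpret W: module K W by fact
  have c: "f \<zero>\<^bsub>V\<^esub> \<in> carrier W" using assms(3) unfolding linear_map_def by blast
  have "f \<zero>\<^bsub>V\<^esub> = f (\<zero>\<^bsub>K\<^esub> \<odot>\<^bsub>V\<^esub> \<zero>\<^bsub>V\<^esub>)" by simp
  also have "\<dots> = \<zero>\<^bsub>K\<^esub> \<odot>\<^bsub>W\<^esub> f \<zero>\<^bsub>V\<^esub>" 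
    using assms(3) V.R.zero_closed V.zero_closed unfolding linear_map_def by blast
  also have "\<dots> = \<zero>\<^bsub>W\<^esub>" using c by simp
  finally show ?thesis .
qed

lemma linear_map_minus:
  assumes "module K V" "module K W" "linear_map K V W f" "x \<in> carrier V" "y \<in> carrier V"
  shows "f (x \<ominus>\<^bsub>V\<^esub> y) = f x \<ominus>\<^bsub>W\<^esub> f y"
proof -
  interpret V: module K V by fact
  interpret W: module K W by fact
  have c: "f y \<in> carrier W" using assms(3,5) unfolding linear_map_def by blast
  have m: "\<ominus>\<^bsub>V\<^esub> y = (\<ominus>\<^bsub>K\<^esub> \<one>\<^bsub>K\<^esub>) \<odot>\<^bsub>V\<^esub> y" "\<ominus>\<^bsub>W\<^esub> f y = (\<ominus>\<^bsub>K\<^esub> \<one>\<^bsub>K\<^esub>) \<odot>\<^bsub>W\<^esub> f y"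
    using assms(5) c by (simp_all add: V.smult_l_minus W.smult_l_minus)
  show ?thesis
  proof -
    have k: "\<ominus>\<^bsub>K\<^esub> \<one>\<^bsub>K\<^esub> \<in> carrier K" by simp
    have "f (x \<oplus>\<^bsub>V\<^esub> ((\<ominus>\<^bsub>K\<^esub> \<one>\<^bsub>K\<^esub>) \<odot>\<^bsub>V\<^esub> y)) = f x \<oplus>\<^bsub>W\<^esub> f ((\<ominus>\<^bsub>K\<^esub> \<one>\<^bsub>K\<^esub>) \<odot>\<^bsub>V\<^esub> y)"
      using assms(3,4) V.smult_closed[OF k assms(5)] unfolding linear_map_def by blast
    moreover have "f ((\<ominus>\<^bsub>K\<^esub> \<one>\<^bsub>K\<^esub>) \<odot>\<^bsub>V\<^esub> y) = (\<ominus>\<^bsub>K\<^esub> \<one>\<^bsub>K\<^esub>) \<odot>\<^bsub>W\<^esub> f y"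
      using assms(3,5) k unfolding linear_map_def by blast
    ultimately show ?thesis by (simp only: V.minus_eq W.minus_eq m)
  qed
qed

context
  fixes K :: "('k, 'm) ring_scheme" and V :: "('k, 'a, 'p) module_scheme"
    and W :: "('k, 'b, 'q) module_scheme"
  assumes V: "module K V" and W: "module K W"
begin

interpretation V: module K V by (rule V)
interpretation W: module K W by (rule W)

private abbreviation F where "F \<equiv> free_module K (carrier V \<times> carrier W)"

interpretation F: module K F by (rule free_module_module) (rule V.R.cring_axioms)

private lemma gen: "x \<in> carrier V \<Longrightarrow> y \<in> carrier W \<Longrightarrow> free_gen K (x, y) \<in> carrier F"
  by (simp add: free_gen_closed V.R.cring_axioms)

private lemma rels_closed: "tensor_rels K V W \<subseteq> carrier F"
proof
  fix g assume "g \<in> tensor_rels K V W"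
  then show "g \<in> carrier F"
    unfolding tensor_rels_def Let_def
    by (elim UnE CollectE exE conjE)
       (simp_all only: F.minus_closed F.a_closed F.smult_closed gen
         V.a_closed W.a_closed V.smult_closed W.smult_closed)
qed

private lemma null_submodule: "submodule (tensor_null K V W) K F"
  unfolding tensor_null_def
  by (rule submodule_span_submodule[OF F.module_axioms rels_closed])

interpretation N: abelian_subgroup "tensor_null K V W" F
  by (rule submodule_abelian_subgroup[OF F.module_axioms null_submodule])

lemma tensor_module: "module K (tensor K V W)"
  unfolding tensor_def by (rule quotient_module_module[OF F.module_axioms null_submodule])

interpretation T: module K "tensor K V W" by (rule tensor_module)

private lemmas tsimps = quotient_module_simps[OF F.module_axioms null_submodule, folded tensor_def]

private abbreviation cos where "cos g \<equiv> tensor_null K V W +>\<^bsub>F\<^esub> g"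

private lemma coset_eqI:
  assumes "g \<ominus>\<^bsub>F\<^esub> h \<in> tensor_rels K V W" "g \<in> carrier F" "h \<in> carrier F"
  shows "cos g = cos h"
proof -
  have "g \<ominus>\<^bsub>F\<^esub> h \<in> tensor_null K V W"
    unfolding tensor_null_def by (rule subsetD[OF submodule_span_superset assms(1)])
  then have "g \<in> cos h"
    using N.a_rcos_module[OF assms(3,2)] by (simp add: F.minus_eq)
  then show ?thesis using N.a_repr_independence'[OF _ assms(3)] by simp
qed

private lemma rels:
  "x \<in> carrier V \<Longrightarrow> x' \<in> carrier V \<Longrightarrow> y \<in> carrier W \<Longrightarrow>
    free_gen K (x \<oplus>\<^bsub>V\<^esub> x', y) \<ominus>\<^bsub>F\<^esub> (free_gen K (x, y) \<oplus>\<^bsub>F\<^esub> free_gen K (x', y)) \<in> tensor_rels K V W"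
  "x \<in> carrier V \<Longrightarrow> y \<in> carrier W \<Longrightarrow> y' \<in> carrier W \<Longrightarrow>
    free_gen K (x, y \<oplus>\<^bsub>W\<^esub> y') \<ominus>\<^bsub>F\<^esub> (free_gen K (x, y) \<oplus>\<^bsub>F\<^esub> free_gen K (x, y')) \<in> tensor_rels K V W"
  "c \<in> carrier K \<Longrightarrow> x \<in> carrier V \<Longrightarrow> y \<in> carrier W \<Longrightarrow>
    free_gen K (c \<odot>\<^bsub>V\<^esub> x, y) \<ominus>\<^bsub>F\<^esub> (c \<odot>\<^bsub>F\<^esub> free_gen K (x, y)) \<in> tensor_rels K V W"
  "c \<in> carrier K \<Longrightarrow> x \<in> carrier V \<Longrightarrow> y \<in> carrier W \<Longrightarrow>
    free_gen K (x, c \<odot>\<^bsub>W\<^esub> y) \<ominus>\<^bsub>F\<^esub> (c \<odot>\<^bsub>F\<^esub> free_gen K (x, y)) \<in> tensor_rels K V W"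
  unfolding tensor_rels_def Let_def by blast+

lemma tensor_pure_closed:
  "x \<in> carrier V \<Longrightarrow> y \<in> carrier W \<Longrightarrow> tensor_pure K V W x y \<in> carrier (tensor K V W)"
  by (simp add: tensor_pure_def tsimps(1) gen)

lemma tensor_pure_bilinear: "bilinear_map K V W (tensor K V W) (tensor_pure K V W)"
  unfolding bilinear_map_def linear_map_def
proof (intro conjI ballI funcsetI)
  fix x y y' assume *: "x \<in> carrier V" "y \<in> carrier W" "y' \<in> carrier W"
  show "tensor_pure K V W x (y \<oplus>\<^bsub>W\<^esub> y') =
    tensor_pure K V W x y \<oplus>\<^bsub>tensor K V W\<^esub> tensor_pure K V W x y'"
    unfolding tensor_pure_def using *
    by (subst tsimps(3)) (simp_all only: gen, intro coset_eqI rels(2), simp_all add: gen)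
next
  fix x c y assume *: "x \<in> carrier V" "c \<in> carrier K" "y \<in> carrier W"
  show "tensor_pure K V W x (c \<odot>\<^bsub>W\<^esub> y) = c \<odot>\<^bsub>tensor K V W\<^esub> tensor_pure K V W x y"
    unfolding tensor_pure_def using *
    by (subst tsimps(4)) (simp_all only: gen, intro coset_eqI rels(4), simp_all add: gen)
next
  fix y x x' assume *: "y \<in> carrier W" "x \<in> carrier V" "x' \<in> carrier V"
  show "tensor_pure K V W (x \<oplus>\<^bsub>V\<^esub> x') y =
    tensor_pure K V W x y \<oplus>\<^bsub>tensor K V W\<^esub> tensor_pure K V W x' y"
    unfolding tensor_pure_def using *
    by (subst tsimps(3)) (simp_all only: gen, intro coset_eqI rels(1), simp_all add: gen)
next
  fix y c x assume *: "y \<in> carrier W" "c \<in> carrier K" "x \<in> carrier V"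
  show "tensor_pure K V W (c \<odot>\<^bsub>V\<^esub> x) y = c \<odot>\<^bsub>tensor K V W\<^esub> tensor_pure K V W x y"
    unfolding tensor_pure_def using *
    by (subst tsimps(4)) (simp_all only: gen, intro coset_eqI rels(3), simp_all add: gen)
qed (auto intro: tensor_pure_closed)

lemma tensor_linear_eqI:
  assumes "module K U"
    and "linear_map K (tensor K V W) U h" "linear_map K (tensor K V W) U k"
    and eq: "\<And>x y. x \<in> carrier V \<Longrightarrow> y \<in> carrier W \<Longrightarrow>
      h (tensor_pure K V W x y) = k (tensor_pure K V W x y)"
    and "t \<in> carrier (tensor K V W)"
  shows "h t = k t"
proof -
  interpret U: module K U by fact
  obtain g where g: "g \<in> carrier F" "t = cos g" using assms(5) by (auto simp: tsimps(1))
  have cl: "cos g \<in> carrier (tensor K V W)" if "g \<in> carrier F" for g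
    using that by (simp add: tsimps(1))
  have "h (cos g) = k (cos g)"
    using V.R.cring_axioms g(1)
  proof (induction rule: free_module_induct)
    case zero
    show ?case
      using linear_map_zero[OF tensor_module assms(1,2)] linear_map_zero[OF tensor_module assms(1,3)]
      by (simp add: tsimps(2))
  next
    case (add c s g)
    obtain x y where s: "s = (x, y)" "x \<in> carrier V" "y \<in> carrier W" using add(2) by auto
    have "cos ((c \<odot>\<^bsub>F\<^esub> free_gen K s) \<oplus>\<^bsub>F\<^esub> g) =
      (c \<odot>\<^bsub>tensor K V W\<^esub> tensor_pure K V W x y) \<oplus>\<^bsub>tensor K V W\<^esub> cos g"
      using add s gen by (simp add: tensor_pure_def tsimps(3,4))
    moreover have "tensor_pure K V W x y \<in> carrier (tensor K V W)"
      using s by (simp add: tensor_pure_closed)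
    ultimately show ?case
      using assms(2,3) add s eq cl[OF add(3)] by (simp add: linear_map_def)
  qed
  with g show ?thesis by simp
qed

context
  fixes U :: "('k, 'c, 'r) module_scheme" and f
  assumes U: "module K U" and f: "bilinear_map K V W U f"
begin

interpretation U: module K U by (rule U)

private abbreviation ext where "ext \<equiv> free_extend K U (\<lambda>p. f (fst p) (snd p))"

private lemma f_pi: "(\<lambda>p. f (fst p) (snd p)) \<in> carrier V \<times> carrier W \<rightarrow> carrier U"
proof (rule funcsetI)
  fix p assume "p \<in> carrier V \<times> carrier W"
  then show "f (fst p) (snd p) \<in> carrier U"
    using f unfolding bilinear_map_def linear_map_def
    by (metis funcset_mem mem_Times_iff)
qed

private lemma ext_linear: "linear_map K F U ext"
  by (rule free_extend_linear[OF U f_pi])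

private lemma ext_gen: "x \<in> carrier V \<Longrightarrow> y \<in> carrier W \<Longrightarrow> ext (free_gen K (x, y)) = f x y"
  using free_extend_gen[OF U _ f_pi, of "(x, y)"] by simp

private lemma ext_null: "g \<in> tensor_null K V W \<Longrightarrow> ext g = \<zero>\<^bsub>U\<^esub>"
proof -
  let ?N = "{g \<in> carrier F. ext g = \<zero>\<^bsub>U\<^esub>}"
  have lin: "g \<in> carrier F \<Longrightarrow> h \<in> carrier F \<Longrightarrow> ext (g \<oplus>\<^bsub>F\<^esub> h) = ext g \<oplus>\<^bsub>U\<^esub> ext h"
    "g \<in> carrier F \<Longrightarrow> c \<in> carrier K \<Longrightarrow> ext (c \<odot>\<^bsub>F\<^esub> g) = c \<odot>\<^bsub>U\<^esub> ext g" for g h c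
    using ext_linear by (simp_all add: linear_map_def)
  have minus: "ext (g \<ominus>\<^bsub>F\<^esub> h) = ext g \<ominus>\<^bsub>U\<^esub> ext h" if "g \<in> carrier F" "h \<in> carrier F" for g h
    by (rule linear_map_minus[OF F.module_axioms U ext_linear that])
  have zero: "ext \<zero>\<^bsub>F\<^esub> = \<zero>\<^bsub>U\<^esub>" by (rule linear_map_zero[OF F.module_axioms U ext_linear])
  have self: "u \<ominus>\<^bsub>U\<^esub> u = \<zero>\<^bsub>U\<^esub>" if "u \<in> carrier U" for u
    using that by (simp add: U.minus_eq U.r_neg)
  have fc: "f x y \<in> carrier U" if "x \<in> carrier V" "y \<in> carrier W" for x y
    using funcset_mem[OF f_pi, of "(x, y)"] that by simp
  have bil:
    "x \<in> carrier V \<Longrightarrow> x' \<in> carrier V \<Longrightarrow> y \<in> carrier W \<Longrightarrow> f (x \<oplus>\<^bsub>V\<^esub> x') y = f x y \<oplus>\<^bsub>U\<^esub> f x' y"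
    "x \<in> carrier V \<Longrightarrow> y \<in> carrier W \<Longrightarrow> y' \<in> carrier W \<Longrightarrow> f x (y \<oplus>\<^bsub>W\<^esub> y') = f x y \<oplus>\<^bsub>U\<^esub> f x y'"
    "x \<in> carrier V \<Longrightarrow> y \<in> carrier W \<Longrightarrow> c \<in> carrier K \<Longrightarrow> f (c \<odot>\<^bsub>V\<^esub> x) y = c \<odot>\<^bsub>U\<^esub> f x y"
    "x \<in> carrier V \<Longrightarrow> y \<in> carrier W \<Longrightarrow> c \<in> carrier K \<Longrightarrow> f x (c \<odot>\<^bsub>W\<^esub> y) = c \<odot>\<^bsub>U\<^esub> f x y"
    for x x' y y' c
    using f unfolding bilinear_map_def linear_map_def by simp_all
  have "submodule ?N K F"
  proof (rule F.submoduleI)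
    fix a assume a: "a \<in> ?N"
    have "ext (\<zero>\<^bsub>F\<^esub> \<ominus>\<^bsub>F\<^esub> a) = \<zero>\<^bsub>U\<^esub>" using a zero by (subst minus) (auto simp: self)
    moreover have "\<zero>\<^bsub>F\<^esub> \<ominus>\<^bsub>F\<^esub> a = \<ominus>\<^bsub>F\<^esub> a" using a by (simp add: F.minus_eq)
    ultimately show "\<ominus>\<^bsub>F\<^esub> a \<in> ?N" using a by simp
  qed (auto simp: lin zero)
  moreover have "tensor_rels K V W \<subseteq> ?N"
  proof
    fix g assume g: "g \<in> tensor_rels K V W"
    have "ext g = \<zero>\<^bsub>U\<^esub>"
      using g unfolding tensor_rels_def Let_def
      by (elim UnE CollectE exE conjE) (simp_all add: minus lin gen ext_gen self bil fc)
    then show "g \<in> ?N" using g rels_closed by auto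
  qed
  ultimately have "tensor_null K V W \<subseteq> ?N"
    unfolding tensor_null_def by (rule submodule_span_minimal)
  then show "ext g = \<zero>\<^bsub>U\<^esub>" if "g \<in> tensor_null K V W"
    using that by blast
qed

private lemma lift_cos:
  assumes g: "g \<in> carrier F"
  shows "tensor_lift K U f (cos g) = ext g"
proof -
  have "(SOME h. h \<in> cos g) \<in> cos g"
    using N.a_rcos_self[OF g] by (rule someI[of "\<lambda>h. h \<in> cos g"])
  then obtain n where n: "n \<in> tensor_null K V W" "(SOME h. h \<in> cos g) = n \<oplus>\<^bsub>F\<^esub> g"
    by (auto simp: a_r_coset_def r_coset_def)
  have nc: "n \<in> carrier F" using n(1) N.a_subset by blast
  have "ext g \<in> carrier U" using ext_linear g by (auto simp: linear_map_def)
  moreover have "ext (n \<oplus>\<^bsub>F\<^esub> g) = ext n \<oplus>\<^bsub>U\<^esub> ext g"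
    using ext_linear nc g by (simp add: linear_map_def)
  ultimately show ?thesis
    by (simp add: tensor_lift_def n ext_null)
qed

lemma tensor_lift_pure:
  "x \<in> carrier V \<Longrightarrow> y \<in> carrier W \<Longrightarrow> tensor_lift K U f (tensor_pure K V W x y) = f x y"
  by (simp add: tensor_pure_def lift_cos gen ext_gen)

lemma tensor_lift_linear: "linear_map K (tensor K V W) U (tensor_lift K U f)"
  using ext_linear unfolding linear_map_def
  by (auto simp: tsimps lift_cos)

end

end


section \<open>Hom-bialgebras\<close>

text \<open>
  The third tensor power is \<open>(A \<otimes> A) \<otimes> A\<close>; maps into or out of \<open>A \<otimes> (A \<otimes> A)\<close> are transported along
  \<open>tensor_assoc\<close>.
\<close>

abbreviation tensor2 where "tensor2 K A \<equiv> tensor K A A"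

abbreviation tensor3 where "tensor3 K A \<equiv> tensor K (tensor K A A) A"

abbreviation pure2 where "pure2 K A \<equiv> tensor_pure K A A"

abbreviation pure3 where "pure3 K A x y z \<equiv> tensor_pure K (tensor K A A) A (tensor_pure K A A x y) z"

locale char_zero_vector_space = field K + module K A
  for K :: "('k, 'm) ring_scheme" (structure) and A :: "('k, 'a, 'p) module_scheme" (structure) +
  assumes char_zero: "(n::nat) > 0 \<Longrightarrow> [n] \<cdot>\<^bsub>K\<^esub> \<one>\<^bsub>K\<^esub> \<noteq> \<zero>\<^bsub>K\<^esub>"

locale eps_hom_bialgebra = char_zero_vector_space K A
  for K :: "('k, 'm) ring_scheme" (structure) and A :: "('k, 'a, 'p) module_scheme" (structure) +
  fixes \<mu> :: "('a \<times> 'a \<Rightarrow> 'k) set \<Rightarrow> 'a"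
    and \<Delta> :: "'a \<Rightarrow> ('a \<times> 'a \<Rightarrow> 'k) set"
    and \<alpha> :: "'a \<Rightarrow> 'a"
  assumes mu_linear: "linear_map K (tensor2 K A) A \<mu>"
    and Delta_linear: "linear_map K A (tensor2 K A) \<Delta>"
    and alpha_linear: "linear_map K A A \<alpha>"
    and mu_multiplicative:
      "t \<in> carrier (tensor2 K A) \<Longrightarrow> \<alpha> (\<mu> t) = \<mu> (tensor_map K A A \<alpha> \<alpha> t)"
    and hom_associative:
      "s \<in> carrier (tensor K A (tensor2 K A)) \<Longrightarrow>
        \<mu> (tensor_map K A A \<alpha> \<mu> s) = \<mu> (tensor_map K A A \<mu> \<alpha> (tensor_assoc K A A A s))"
    and Delta_comultiplicative:
      "a \<in> carrier A \<Longrightarrow> tensor_map K A A \<alpha> \<alpha> (\<Delta> a) = \<Delta> (\<alpha> a)"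
    and hom_coassociative:
      "a \<in> carrier A \<Longrightarrow>
        tensor_assoc K A A A (tensor_map K A (tensor2 K A) \<alpha> \<Delta> (\<Delta> a))
          = tensor_map K (tensor2 K A) A \<Delta> \<alpha> (\<Delta> a)"
    and compatibility:
      "t \<in> carrier (tensor2 K A) \<Longrightarrow>
        \<Delta> (\<mu> t) =
          tensor_map K A A \<mu> \<alpha> (tensor_assoc K A A A (tensor_map K A (tensor2 K A) \<alpha> \<Delta> t))
          \<oplus>\<^bsub>tensor2 K A\<^esub>
          tensor_map K A A \<alpha> \<mu> (tensor_assoc_inv K A A A (tensor_map K (tensor2 K A) A \<Delta> \<alpha> t))"

text \<open>\<open>hom_bracket K A \<mu> \<alpha> a r\<close> is \<open>[a, r]\<^sub>*\<close>.\<close>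

definition hom_bracket ::
  "('k, 'm) ring_scheme \<Rightarrow> ('k, 'a, 'p) module_scheme
    \<Rightarrow> (('a \<times> 'a \<Rightarrow> 'k) set \<Rightarrow> 'a) \<Rightarrow> ('a \<Rightarrow> 'a) \<Rightarrow> 'a \<Rightarrow> ('a \<times> 'a \<Rightarrow> 'k) set \<Rightarrow> ('a \<times> 'a \<Rightarrow> 'k) set"
  where "hom_bracket K A \<mu> \<alpha> a r =
    tensor_lift K (tensor2 K A)
      (\<lambda>u v. pure2 K A (\<mu> (pure2 K A a u)) (\<alpha> v)
             \<ominus>\<^bsub>tensor2 K A\<^esub> pure2 K A (\<alpha> u) (\<mu> (pure2 K A v a))) r"

text \<open>
  The double sum defining \<open>A(r)\<close> is the bilinear extension to \<open>(r, r)\<close> of its summand, a function of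
  \<open>u\<^sub>i \<otimes> v\<^sub>i\<close> and \<open>u\<^sub>j \<otimes> v\<^sub>j\<close>.
\<close>

definition ahybe ::
  "('k, 'm) ring_scheme \<Rightarrow> ('k, 'a, 'p) module_scheme
    \<Rightarrow> (('a \<times> 'a \<Rightarrow> 'k) set \<Rightarrow> 'a) \<Rightarrow> ('a \<Rightarrow> 'a) \<Rightarrow> ('a \<times> 'a \<Rightarrow> 'k) set
    \<Rightarrow> (('a \<times> 'a \<Rightarrow> 'k) set \<times> 'a \<Rightarrow> 'k) set"
  where "ahybe K A \<mu> \<alpha> r =
    tensor_lift K (tensor3 K A) (\<lambda>ui vi.
      tensor_lift K (tensor3 K A) (\<lambda>uj vj.
        pure3 K A (\<mu> (pure2 K A ui uj)) (\<alpha> vj) (\<alpha> vi)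
        \<ominus>\<^bsub>tensor3 K A\<^esub> pure3 K A (\<alpha> ui) (\<mu> (pure2 K A vi uj)) (\<alpha> vj)
        \<oplus>\<^bsub>tensor3 K A\<^esub> pure3 K A (\<alpha> uj) (\<alpha> ui) (\<mu> (pure2 K A vi vj))) r) r"

locale coboundary_eps_hom_bialgebra = eps_hom_bialgebra K A \<mu> \<Delta> \<alpha>
  for K :: "('k, 'm) ring_scheme" (structure) and A :: "('k, 'a, 'p) module_scheme" (structure)
    and \<mu> \<Delta> \<alpha> +
  fixes r :: "('a \<times> 'a \<Rightarrow> 'k) set"
  assumes r_closed: "r \<in> carrier (tensor2 K A)"
    and r_invariant: "tensor_map K A A \<alpha> \<alpha> r = r"
    and Delta_coboundary: "a \<in> carrier A \<Longrightarrow> \<Delta> a = hom_bracket K A \<mu> \<alpha> a r"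

locale quasi_triangular_eps_hom_bialgebra = coboundary_eps_hom_bialgebra K A \<mu> \<Delta> \<alpha> r
  for K :: "('k, 'm) ring_scheme" (structure) and A :: "('k, 'a, 'p) module_scheme" (structure)
    and \<mu> \<Delta> \<alpha> r +
  assumes ahybe_zero: "ahybe K A \<mu> \<alpha> r = \<zero>\<^bsub>tensor3 K A\<^esub>"

end

(* The axioms are stable under twisting by a single endomorphism: if a linear map \<beta> commutes with
   \<alpha>, \<mu> and \<Delta> and fixes r, then (A, \<beta>\<mu>, \<Delta>\<beta>, \<beta>\<alpha>, r) is again quasi-triangular, because each
   axiom for the twist is the image under tensor powers of \<beta> of the axiom for A. In particular the
   new bracket is (\<beta> \<otimes> \<beta>)[-, r] and the new A(r) is (\<beta> \<otimes> \<beta> \<otimes> \<beta>)(A(r)). The corollary is the case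
   \<beta> = \<alpha>^(2^n - 1), so no induction on n is needed. *)
theory Submission
  imports Defs
begin

section \<open>Linear and bilinear maps\<close>

lemma linear_mapI:
  assumes "\<And>x. x \<in> carrier V \<Longrightarrow> f x \<in> carrier W"
    and "\<And>x y. x \<in> carrier V \<Longrightarrow> y \<in> carrier V \<Longrightarrow> f (x \<oplus>\<^bsub>V\<^esub> y) = f x \<oplus>\<^bsub>W\<^esub> f y"
    and "\<And>c x. c \<in> carrier K \<Longrightarrow> x \<in> carrier V \<Longrightarrow> f (c \<odot>\<^bsub>V\<^esub> x) = c \<odot>\<^bsub>W\<^esub> f x"
  shows "linear_map K V W f"
  using assms by (simp add: linear_map_def)

lemma linear_mapD:
  assumes "linear_map K V W f"
  shows "x \<in> carrier V \<Longrightarrow> f x \<in> carrier W"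
    and "x \<in> carrier V \<Longrightarrow> y \<in> carrier V \<Longrightarrow> f (x \<oplus>\<^bsub>V\<^esub> y) = f x \<oplus>\<^bsub>W\<^esub> f y"
    and "c \<in> carrier K \<Longrightarrow> x \<in> carrier V \<Longrightarrow> f (c \<odot>\<^bsub>V\<^esub> x) = c \<odot>\<^bsub>W\<^esub> f x"
  using assms by (auto simp: linear_map_def)

text \<open>\<open>linear_map\<close> only sees values on the carrier. The module structure keeps
  sums and scalar multiples there, so agreement on the carrier is enough.\<close>

lemma linear_map_cong:
  assumes "module K V" "linear_map K V W f" "\<And>x. x \<in> carrier V \<Longrightarrow> g x = f x"
  shows "linear_map K V W g"
proof -
  interpret V: module K V by fact
  show ?thesis
    using linear_mapD[OF assms(2)] by (intro linear_mapI) (simp_all add: assms(3))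
qed

lemma linear_map_ident: "linear_map K V V (\<lambda>x. x)"
  by (simp add: linear_map_def)

lemma linear_map_compose:
  assumes "linear_map K W U g" "linear_map K V W f"
  shows "linear_map K V U (\<lambda>x. g (f x))"
  using linear_mapD[OF assms(1)] linear_mapD[OF assms(2)] by (intro linear_mapI) simp_all

lemma linear_map_add:
  assumes "module K W" "linear_map K V W f" "linear_map K V W g"
  shows "linear_map K V W (\<lambda>x. f x \<oplus>\<^bsub>W\<^esub> g x)"
proof -
  interpret W: module K W by fact
  note fg = linear_mapD[OF assms(2)] linear_mapD[OF assms(3)]
  show ?thesis
    by (rule linear_mapI) (simp_all add: fg W.a_ac W.smult_r_distr)
qed

lemma linear_map_uminus:
  assumes "module K W"
  shows "linear_map K W W (\<lambda>x. \<ominus>\<^bsub>W\<^esub> x)"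
proof -
  interpret W: module K W by fact
  show ?thesis
    by (rule linear_mapI) (simp_all add: W.minus_add W.smult_r_minus)
qed

lemma linear_map_diff:
  assumes "module K W" "linear_map K V W f" "linear_map K V W g"
  shows "linear_map K V W (\<lambda>x. f x \<ominus>\<^bsub>W\<^esub> g x)"
  unfolding a_minus_def
  by (rule linear_map_add[OF assms(1,2) linear_map_compose[OF linear_map_uminus[OF assms(1)] assms(3)]])

text \<open>This rests on commutativity of \<open>K\<close>: the scalar \<open>c\<close> must move
  past the scalar taken out of the argument of \<open>f\<close>.\<close>

lemma linear_map_smult:
  assumes "module K W" "c \<in> carrier K" "linear_map K V W f"
  shows "linear_map K V W (\<lambda>x. c \<odot>\<^bsub>W\<^esub> f x)"
proof -
  interpret W: module K W by fact
  note f = linear_mapD[OF assms(3)]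
  show ?thesis
    by (rule linear_mapI)
       (use assms(2) in \<open>simp_all add: f W.smult_r_distr W.smult_assoc1[symmetric] W.R.m_comm\<close>)
qed

lemma linear_map_funpow:
  assumes "linear_map K V V f"
  shows "linear_map K V V (f ^^ m)"
proof (induction m)
  case 0
  show ?case by (simp add: linear_map_def)
next
  case (Suc m)
  show ?case using linear_map_compose[OF assms Suc.IH] by (simp add: comp_def)
qed

lemma bilinear_mapI:
  assumes "\<And>x. x \<in> carrier V \<Longrightarrow> linear_map K W U (f x)"
    and "\<And>y. y \<in> carrier W \<Longrightarrow> linear_map K V U (\<lambda>x. f x y)"
  shows "bilinear_map K V W U f"
  using assms by (simp add: bilinear_map_def)

lemma bilinear_mapD:
  assumes "bilinear_map K V W U f"
  shows "x \<in> carrier V \<Longrightarrow> linear_map K W U (f x)"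
    and "y \<in> carrier W \<Longrightarrow> linear_map K V U (\<lambda>x. f x y)"
  using assms by (simp_all add: bilinear_map_def)


section \<open>Functoriality of the tensor product\<close>

lemma linear_map_tensor_pure_left:
  assumes "module K V" "module K W" "linear_map K U V f" "w \<in> carrier W"
  shows "linear_map K U (tensor K V W) (\<lambda>x. tensor_pure K V W (f x) w)"
  using linear_map_compose[OF bilinear_mapD(2)[OF tensor_pure_bilinear[OF assms(1,2)] assms(4)] assms(3)] .

lemma linear_map_tensor_pure_right:
  assumes "module K V" "module K W" "linear_map K U W f" "v \<in> carrier V"
  shows "linear_map K U (tensor K V W) (\<lambda>x. tensor_pure K V W v (f x))"
  using linear_map_compose[OF bilinear_mapD(1)[OF tensor_pure_bilinear[OF assms(1,2)] assms(4)] assms(3)] .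

text \<open>Bilinearity of \<open>f\<close> comes for free: on carriers \<open>f\<close> agrees with
  \<open>h\<close> composed with the bilinear map \<open>tensor_pure\<close>. An identity about
  lifts thus reduces to a linear candidate \<open>h\<close> and a check on pure tensors.\<close>

lemma tensor_lift_eqI:
  assumes "module K V" "module K W" "module K U"
    and "linear_map K (tensor K V W) U h"
    and "\<And>x y. x \<in> carrier V \<Longrightarrow> y \<in> carrier W \<Longrightarrow> f x y = h (tensor_pure K V W x y)"
    and "t \<in> carrier (tensor K V W)"
  shows "tensor_lift K U f t = h t"
proof -
  have "bilinear_map K V W U (\<lambda>x y. h (tensor_pure K V W x y))"
    by (intro bilinear_mapI linear_map_compose[OF assms(4)] linear_map_tensor_pure_left
        linear_map_tensor_pure_right linear_map_ident assms(1,2))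
  then have f: "bilinear_map K V W U f"
    using assms(1,2,5) unfolding bilinear_map_def by (auto intro: linear_map_cong)
  show ?thesis
    by (rule tensor_linear_eqI[OF assms(1-3) tensor_lift_linear[OF assms(1-3) f] assms(4) _ assms(6)])
       (simp add: tensor_lift_pure[OF assms(1-3) f] assms(5))
qed

text \<open>Naturality of the lift in its target. It later carries tensor powers of an endomorphism
  through the sums in the bracket and in A(r).\<close>

lemma tensor_lift_compose:
  assumes "module K V" "module K W" "module K U" "module K U'"
    and "bilinear_map K V W U f" "linear_map K U U' h"
    and "\<And>x y. x \<in> carrier V \<Longrightarrow> y \<in> carrier W \<Longrightarrow> f' x y = h (f x y)"
    and "t \<in> carrier (tensor K V W)"
  shows "tensor_lift K U' f' t = h (tensor_lift K U f t)"
  by (rule tensor_lift_eqI[OF assms(1,2,4)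
        linear_map_compose[OF assms(6) tensor_lift_linear[OF assms(1-3,5)]] _ assms(8)])
     (simp add: assms(7) tensor_lift_pure[OF assms(1-3,5)])

text \<open>Linearity in the parameter for a fixed tensor \<open>t\<close> is an equation between
  two linear maps in \<open>t\<close>, so pure tensors decide it. This is what makes nested lifts
  well behaved.\<close>

lemma tensor_lift_bilinear:
  assumes "module K V" "module K W" "module K U" "module K T"
    and f: "\<And>x. x \<in> carrier U \<Longrightarrow> bilinear_map K V W T (f x)"
    and lin: "\<And>y z. y \<in> carrier V \<Longrightarrow> z \<in> carrier W \<Longrightarrow> linear_map K U T (\<lambda>x. f x y z)"
  shows "bilinear_map K U (tensor K V W) T (\<lambda>x. tensor_lift K T (f x))"
proof -
  interpret U: module K U by fact
  note lift = tensor_lift_linear[OF assms(1,2,4) f]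
  note pure = tensor_lift_pure[OF assms(1,2,4) f]
  show ?thesis
  proof (intro bilinear_mapI linear_mapI)
    fix t x x' assume *: "t \<in> carrier (tensor K V W)" "x \<in> carrier U" "x' \<in> carrier U"
    show "tensor_lift K T (f (x \<oplus>\<^bsub>U\<^esub> x')) t = tensor_lift K T (f x) t \<oplus>\<^bsub>T\<^esub> tensor_lift K T (f x') t"
      by (rule tensor_lift_eqI[OF assms(1,2,4) linear_map_add[OF assms(4) lift lift]])
         (use * in \<open>simp_all add: pure linear_mapD(2)[OF lin]\<close>)
  next
    fix t c x assume *: "t \<in> carrier (tensor K V W)" "c \<in> carrier K" "x \<in> carrier U"
    show "tensor_lift K T (f (c \<odot>\<^bsub>U\<^esub> x)) t = c \<odot>\<^bsub>T\<^esub> tensor_lift K T (f x) t"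
      by (rule tensor_lift_eqI[OF assms(1,2,4) linear_map_smult[OF assms(4) _ lift]])
         (use * in \<open>simp_all add: pure linear_mapD(3)[OF lin]\<close>)
  qed (simp_all add: linear_mapD[OF lift])
qed

lemma bilinear_map_swap: "bilinear_map K V W U f \<Longrightarrow> bilinear_map K W V U (\<lambda>y x. f x y)"
  by (simp add: bilinear_map_def)

section \<open>Tensor products of linear maps\<close>

context
  fixes K :: "('k, 'm) ring_scheme"
    and V :: "('k, 'a, 'p) module_scheme" and W :: "('k, 'b, 'q) module_scheme"
    and V' :: "('k, 'c, 'r) module_scheme" and W' :: "('k, 'd, 's) module_scheme"
    and f g
  assumes V: "module K V" and W: "module K W" and V': "module K V'" and W': "module K W'"
    and f: "linear_map K V V' f" and g: "linear_map K W W' g"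
begin

private lemma bil: "bilinear_map K V W (tensor K V' W') (\<lambda>x y. tensor_pure K V' W' (f x) (g y))"
  by (intro bilinear_mapI linear_map_tensor_pure_left linear_map_tensor_pure_right V' W' f g
      linear_mapD(1)[OF f] linear_mapD(1)[OF g])

lemma tensor_map_linear: "linear_map K (tensor K V W) (tensor K V' W') (tensor_map K V' W' f g)"
  unfolding tensor_map_def
  by (rule tensor_lift_linear[OF V W tensor_module[OF V' W'] bil])

lemma tensor_map_pure:
  "x \<in> carrier V \<Longrightarrow> y \<in> carrier W \<Longrightarrow>
    tensor_map K V' W' f g (tensor_pure K V W x y) = tensor_pure K V' W' (f x) (g y)"
  unfolding tensor_map_def
  by (rule tensor_lift_pure[OF V W tensor_module[OF V' W'] bil])

end

lemma tensor_map_compose: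
  assumes "module K V" "module K W" "module K V'" "module K W'" "module K V''" "module K W''"
    and "linear_map K V V' f" "linear_map K W W' g"
    and "linear_map K V' V'' f'" "linear_map K W' W'' g'"
    and "t \<in> carrier (tensor K V W)"
  shows "tensor_map K V'' W'' (f' \<circ> f) (g' \<circ> g) t =
    tensor_map K V'' W'' f' g' (tensor_map K V' W' f g t)"
  unfolding tensor_map_def[of K V'' W'' "f' \<circ> f"]
  by (rule tensor_lift_eqI[OF assms(1,2) tensor_module[OF assms(5,6)]
        linear_map_compose[OF tensor_map_linear[OF assms(3-6,9,10)] tensor_map_linear[OF assms(1-4,7,8)]]
        _ assms(11)])
     (simp add: tensor_map_pure[OF assms(1-4,7,8)] tensor_map_pure[OF assms(3-6,9,10)]
        linear_mapD(1)[OF assms(7)] linear_mapD(1)[OF assms(8)])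

lemma tensor_map_id:
  assumes "module K V" "module K W" "t \<in> carrier (tensor K V W)"
  shows "tensor_map K V W id id t = t"
  unfolding tensor_map_def
  by (rule tensor_lift_eqI[OF assms(1,2) tensor_module[OF assms(1,2)] linear_map_ident _ assms(3)]) simp

text \<open>An iterate of one fixed map on the tensor square lets facts about powers of
  \<open>f\<close> follow by induction, with one use of the fact about \<open>f\<close> per
  step.\<close>

lemma tensor_map_funpow:
  assumes "module K V" "linear_map K V V f" "t \<in> carrier (tensor K V V)"
  shows "tensor_map K V V (f ^^ m) (f ^^ m) t = (tensor_map K V V f f ^^ m) t"
proof (induction m)
  case 0
  show ?case using tensor_map_id[OF assms(1,1,3)] by (simp add: id_def)
next
  case (Suc m)
  note fm = linear_map_funpow[OF assms(2)]
  show ?case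
    using tensor_map_compose[OF assms(1,1,1,1,1,1) fm fm assms(2,2,3), of m m] Suc.IH
    by (simp add: comp_def)
qed

section \<open>Reassociation of triple tensor products\<close>

context
  fixes K :: "('k, 'm) ring_scheme" and U :: "('k, 'a, 'p) module_scheme"
    and V :: "('k, 'b, 'q) module_scheme" and W :: "('k, 'c, 'r) module_scheme"
  assumes U: "module K U" and V: "module K V" and W: "module K W"
begin

lemma tensor_assoc_linear:
  "linear_map K (tensor K U (tensor K V W)) (tensor K (tensor K U V) W) (tensor_assoc K U V W)"
  unfolding tensor_assoc_def Let_def
  by (intro tensor_lift_linear tensor_lift_bilinear bilinear_mapI linear_map_tensor_pure_left
      linear_map_tensor_pure_right linear_map_ident tensor_module tensor_pure_closed U V W)

lemma tensor_assoc_inv_linear: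
  "linear_map K (tensor K (tensor K U V) W) (tensor K U (tensor K V W)) (tensor_assoc_inv K U V W)"
  unfolding tensor_assoc_inv_def Let_def
  \<comment> \<open>The inner lift acts on the first argument of the outer one, so the arguments are
    exchanged before \<open>tensor_lift_bilinear\<close> applies.\<close>
  by (intro tensor_lift_linear bilinear_map_swap[OF tensor_lift_bilinear] bilinear_mapI
      linear_map_tensor_pure_left linear_map_tensor_pure_right linear_map_ident tensor_module
      tensor_pure_closed U V W)

end


section \<open>Twisting by an endomorphism\<close>

context eps_hom_bialgebra
begin

lemmas A_module = module_axioms
lemmas T2_module = tensor_module[OF A_module A_module]
lemmas T3_module = tensor_module[OF T2_module A_module]

text \<open>Together with \<open>closed_intros\<close> these follow the shape of a term, so each
  (multi)linearity claim below is settled by descending to the variable.\<close>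

lemmas linear_intros = linear_map_add linear_map_diff linear_map_tensor_pure_left
  linear_map_tensor_pure_right linear_map_compose[OF mu_linear] linear_map_compose[OF alpha_linear]
  linear_map_ident A_module T2_module T3_module

lemmas closed_intros = tensor_pure_closed linear_mapD(1)[OF mu_linear] linear_mapD(1)[OF alpha_linear]
  linear_mapD(1)[OF Delta_linear] A_module T2_module

lemma hom_bracket_summand_bilinear:
  assumes "a \<in> carrier A"
  shows "bilinear_map K A A (tensor2 K A)
    (\<lambda>u v. pure2 K A (\<mu> (pure2 K A a u)) (\<alpha> v)
           \<ominus>\<^bsub>tensor2 K A\<^esub> pure2 K A (\<alpha> u) (\<mu> (pure2 K A v a)))"
  by (intro bilinear_mapI linear_intros closed_intros assms)

text \<open>The summand of A(r), curried with the outer pair first: partial application to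
  \<open>ui vi\<close> is then exactly the function lifted by the inner sum.\<close>

definition ahybe_summand where
  "ahybe_summand ui vi uj vj =
    pure3 K A (\<mu> (pure2 K A ui uj)) (\<alpha> vj) (\<alpha> vi)
    \<ominus>\<^bsub>tensor3 K A\<^esub> pure3 K A (\<alpha> ui) (\<mu> (pure2 K A vi uj)) (\<alpha> vj)
    \<oplus>\<^bsub>tensor3 K A\<^esub> pure3 K A (\<alpha> uj) (\<alpha> ui) (\<mu> (pure2 K A vi vj))"

lemma ahybe_summand_bilinear:
  assumes "ui \<in> carrier A" "vi \<in> carrier A"
  shows "bilinear_map K A A (tensor3 K A) (ahybe_summand ui vi)"
  unfolding ahybe_summand_def
  by (intro bilinear_mapI linear_intros closed_intros assms)

text \<open>Shows that the outer sum of A(r) is a lift of a bilinear map. With one of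
  \<open>ui\<close>, \<open>vi\<close> fixed, the other serves as the parameter of the inner lift,
  which is then evaluated at \<open>r\<close>.\<close>

lemma ahybe_inner_bilinear:
  assumes r: "r \<in> carrier (tensor2 K A)"
  shows "bilinear_map K A A (tensor3 K A)
    (\<lambda>ui vi. tensor_lift K (tensor3 K A) (ahybe_summand ui vi) r)"
proof (rule bilinear_mapI)
  fix ui assume ui: "ui \<in> carrier A"
  have "bilinear_map K A (tensor2 K A) (tensor3 K A)
    (\<lambda>vi. tensor_lift K (tensor3 K A) (ahybe_summand ui vi))"
    by (rule tensor_lift_bilinear[OF A_module A_module A_module T3_module])
       (intro ahybe_summand_bilinear ui, simp, unfold ahybe_summand_def,
        intro linear_intros closed_intros ui)
  from bilinear_mapD(2)[OF this r]
  show "linear_map K A (tensor3 K A) (\<lambda>vi. tensor_lift K (tensor3 K A) (ahybe_summand ui vi) r)" .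
next
  fix vi assume vi: "vi \<in> carrier A"
  have "bilinear_map K A (tensor2 K A) (tensor3 K A)
    (\<lambda>ui. tensor_lift K (tensor3 K A) (ahybe_summand ui vi))"
    by (rule tensor_lift_bilinear[OF A_module A_module A_module T3_module])
       (intro ahybe_summand_bilinear vi, simp, unfold ahybe_summand_def,
        intro linear_intros closed_intros vi)
  from bilinear_mapD(2)[OF this r]
  show "linear_map K A (tensor3 K A) (\<lambda>ui. tensor_lift K (tensor3 K A) (ahybe_summand ui vi) r)" .
qed

section \<open>Twisting the structure by an endomorphism \<beta>\<close>

context
  fixes \<beta>
  assumes beta_linear: "linear_map K A A \<beta>"
    and beta_alpha: "\<And>a. \<beta> (\<alpha> a) = \<alpha> (\<beta> a)"
    and beta_mu: "\<And>t. t \<in> carrier (tensor2 K A) \<Longrightarrow> \<beta> (\<mu> t) = \<mu> (tensor_map K A A \<beta> \<beta> t)"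
    and beta_Delta: "\<And>a. a \<in> carrier A \<Longrightarrow> tensor_map K A A \<beta> \<beta> (\<Delta> a) = \<Delta> (\<beta> a)"
begin

private lemmas beta2_linear =
  tensor_map_linear[OF A_module A_module A_module A_module beta_linear beta_linear]
private lemmas beta3_linear =
  tensor_map_linear[OF T2_module A_module T2_module A_module beta2_linear beta_linear]

private lemmas closed = linear_mapD(1)[OF mu_linear] linear_mapD(1)[OF alpha_linear]
  linear_mapD(1)[OF Delta_linear] linear_mapD(1)[OF beta_linear] linear_mapD(1)[OF beta2_linear]
  tensor_pure_closed[OF A_module A_module] tensor_pure_closed[OF T2_module A_module]

text \<open>Commutation is assumed on the whole type, hence it is an equation of functions and can
  be rewritten inside \<open>tensor_map\<close>.\<close>

private lemma alpha_beta_commute: "\<beta> \<circ> \<alpha> = \<alpha> \<circ> \<beta>"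
  using beta_alpha by auto

private lemmas comp_tensor = tensor_map_compose[OF _ _ A_module A_module A_module A_module _ _ beta_linear beta_linear]

text \<open>Since \<beta> commutes with \<alpha>, a factor \<beta> can be placed on the right in
  both components, and \<beta> \<otimes> \<beta> is applied first. In contrast,
  \<open>comp_tensor\<close> takes \<beta> \<otimes> \<beta> out on the left.\<close>

private lemma alpha_Delta_twist:
  assumes "t \<in> carrier (tensor2 K A)"
  shows "tensor_map K A (tensor2 K A) (\<beta> \<circ> \<alpha>) (\<Delta> \<circ> \<beta>) t =
      tensor_map K A (tensor2 K A) \<alpha> \<Delta> (tensor_map K A A \<beta> \<beta> t)"
    and "tensor_map K (tensor2 K A) A (\<Delta> \<circ> \<beta>) (\<beta> \<circ> \<alpha>) t =
      tensor_map K (tensor2 K A) A \<Delta> \<alpha> (tensor_map K A A \<beta> \<beta> t)"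
  unfolding alpha_beta_commute
  by (intro tensor_map_compose[OF A_module A_module A_module A_module]
      A_module T2_module beta_linear alpha_linear Delta_linear assms)+

text \<open>In each axiom the copies of \<beta> are gathered outside or in the argument, by
  commutation with \<alpha>, \<mu> and \<Delta>; what remains is the original axiom.\<close>

lemma eps_hom_bialgebra_twist: "eps_hom_bialgebra K A (\<beta> \<circ> \<mu>) (\<Delta> \<circ> \<beta>) (\<beta> \<circ> \<alpha>)"
proof (intro eps_hom_bialgebra.intro eps_hom_bialgebra_axioms.intro)
  show "char_zero_vector_space K A" by unfold_locales
  show "linear_map K (tensor2 K A) A (\<beta> \<circ> \<mu>)"
    unfolding comp_def by (rule linear_map_compose[OF beta_linear mu_linear])
  show "linear_map K A (tensor2 K A) (\<Delta> \<circ> \<beta>)"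
    unfolding comp_def by (rule linear_map_compose[OF Delta_linear beta_linear])
  show "linear_map K A A (\<beta> \<circ> \<alpha>)"
    unfolding comp_def by (rule linear_map_compose[OF beta_linear alpha_linear])
next
  fix t assume t: "t \<in> carrier (tensor2 K A)"
  \<comment> \<open>\<open>beta_mu\<close> is available only for tensors in the carrier, so
    membership must be known before \<beta> \<otimes> \<beta> is pulled through \<mu>.\<close>
  have at: "tensor_map K A A \<alpha> \<alpha> t \<in> carrier (tensor2 K A)"
    by (rule linear_mapD(1)[OF tensor_map_linear t]; rule A_module alpha_linear)
  show "(\<beta> \<circ> \<alpha>) ((\<beta> \<circ> \<mu>) t) = (\<beta> \<circ> \<mu>) (tensor_map K A A (\<beta> \<circ> \<alpha>) (\<beta> \<circ> \<alpha>) t)"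
    using t at by (simp add: comp_tensor[OF A_module A_module alpha_linear alpha_linear]
        beta_mu[symmetric] mu_multiplicative[symmetric] beta_alpha)
next
  fix s assume s: "s \<in> carrier (tensor K A (tensor2 K A))"
  have s': "tensor_assoc K A A A s \<in> carrier (tensor3 K A)"
    by (rule linear_mapD(1)[OF tensor_assoc_linear s]; rule A_module)
  have "tensor_map K A A \<alpha> \<mu> s \<in> carrier (tensor2 K A)"
    by (rule linear_mapD(1)[OF tensor_map_linear s]; rule A_module T2_module alpha_linear mu_linear)
  moreover have "tensor_map K A A \<mu> \<alpha> (tensor_assoc K A A A s) \<in> carrier (tensor2 K A)"
    by (rule linear_mapD(1)[OF tensor_map_linear s']; rule A_module T2_module alpha_linear mu_linear)
  \<comment> \<open>Both sides become \<beta> applied twice to the corresponding side of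
    Hom-associativity at \<open>s\<close>.\<close>
  ultimately show "(\<beta> \<circ> \<mu>) (tensor_map K A A (\<beta> \<circ> \<alpha>) (\<beta> \<circ> \<mu>) s) =
      (\<beta> \<circ> \<mu>) (tensor_map K A A (\<beta> \<circ> \<mu>) (\<beta> \<circ> \<alpha>) (tensor_assoc K A A A s))"
    using s s' hom_associative[OF s]
    by (simp add: comp_tensor[OF A_module T2_module alpha_linear mu_linear]
        comp_tensor[OF T2_module A_module mu_linear alpha_linear] beta_mu[symmetric])
next
  fix a assume a: "a \<in> carrier A"
  show "tensor_map K A A (\<beta> \<circ> \<alpha>) (\<beta> \<circ> \<alpha>) ((\<Delta> \<circ> \<beta>) a) = (\<Delta> \<circ> \<beta>) ((\<beta> \<circ> \<alpha>) a)"
    using a by (simp add: comp_tensor[OF A_module A_module alpha_linear alpha_linear] closed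
        Delta_comultiplicative beta_Delta beta_alpha)
  \<comment> \<open>Here \<beta> moves inward instead: the claim becomes Hom-coassociativity at
    \<open>\<beta> (\<beta> a)\<close>.\<close>
  show "tensor_assoc K A A A
      (tensor_map K A (tensor2 K A) (\<beta> \<circ> \<alpha>) (\<Delta> \<circ> \<beta>) ((\<Delta> \<circ> \<beta>) a)) =
    tensor_map K (tensor2 K A) A (\<Delta> \<circ> \<beta>) (\<beta> \<circ> \<alpha>) ((\<Delta> \<circ> \<beta>) a)"
    using a by (simp add: alpha_Delta_twist closed beta_Delta hom_coassociative)
next
  fix t assume t: "t \<in> carrier (tensor2 K A)"
  \<comment> \<open>Of the two copies of \<beta> in the twisted \<Delta>\<mu>, one is absorbed into
    the argument \<open>s\<close> and the other becomes an outer \<beta> \<otimes> \<beta>. The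
    claim is then the image under \<beta> \<otimes> \<beta> of the compatibility axiom at
    \<open>s\<close>.\<close>
  define s where "s = tensor_map K A A \<beta> \<beta> t"
  have s: "s \<in> carrier (tensor2 K A)" using t by (simp add: s_def closed)
  define x where "x = tensor_assoc K A A A (tensor_map K A (tensor2 K A) \<alpha> \<Delta> s)"
  define y where "y = tensor_assoc_inv K A A A (tensor_map K (tensor2 K A) A \<Delta> \<alpha> s)"
  have x: "x \<in> carrier (tensor3 K A)" unfolding x_def
    by (intro linear_mapD(1)[OF tensor_assoc_linear] linear_mapD(1)[OF tensor_map_linear[OF _ _ _ _ alpha_linear Delta_linear]]
        A_module T2_module s)
  have y: "y \<in> carrier (tensor K A (tensor2 K A))" unfolding y_def
    by (intro linear_mapD(1)[OF tensor_assoc_inv_linear] linear_mapD(1)[OF tensor_map_linear[OF _ _ _ _ Delta_linear alpha_linear]]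
        A_module T2_module s)
  have x': "tensor_map K A A \<mu> \<alpha> x \<in> carrier (tensor2 K A)"
    by (rule linear_mapD(1)[OF tensor_map_linear x]; rule A_module T2_module alpha_linear mu_linear)
  have y': "tensor_map K A A \<alpha> \<mu> y \<in> carrier (tensor2 K A)"
    by (rule linear_mapD(1)[OF tensor_map_linear y]; rule A_module T2_module alpha_linear mu_linear)
  have "(\<Delta> \<circ> \<beta>) ((\<beta> \<circ> \<mu>) t) = tensor_map K A A \<beta> \<beta> (\<Delta> (\<mu> s))"
    using t s by (simp add: beta_Delta beta_mu s_def closed)
  also have "\<dots> = tensor_map K A A \<beta> \<beta> (tensor_map K A A \<mu> \<alpha> x)
      \<oplus>\<^bsub>tensor2 K A\<^esub> tensor_map K A A \<beta> \<beta> (tensor_map K A A \<alpha> \<mu> y)"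
    unfolding compatibility[OF s] x_def[symmetric] y_def[symmetric]
    by (rule linear_mapD(2)[OF beta2_linear x' y'])
  finally show "(\<Delta> \<circ> \<beta>) ((\<beta> \<circ> \<mu>) t) =
      tensor_map K A A (\<beta> \<circ> \<mu>) (\<beta> \<circ> \<alpha>)
        (tensor_assoc K A A A (tensor_map K A (tensor2 K A) (\<beta> \<circ> \<alpha>) (\<Delta> \<circ> \<beta>) t))
      \<oplus>\<^bsub>tensor2 K A\<^esub>
      tensor_map K A A (\<beta> \<circ> \<alpha>) (\<beta> \<circ> \<mu>)
        (tensor_assoc_inv K A A A (tensor_map K (tensor2 K A) A (\<Delta> \<circ> \<beta>) (\<beta> \<circ> \<alpha>) t))"
    unfolding alpha_Delta_twist[OF t] s_def[symmetric] x_def[symmetric] y_def[symmetric]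
      comp_tensor[OF A_module T2_module alpha_linear mu_linear y]
      comp_tensor[OF T2_module A_module mu_linear alpha_linear x] .
qed

text \<open>On each pair \<open>u\<close>, \<open>v\<close> the twisted summand is \<beta> \<otimes>
  \<beta> of the old one, and naturality of the lift passes this to \<open>r\<close>.\<close>

lemma hom_bracket_twist:
  assumes a: "a \<in> carrier A" and r: "r \<in> carrier (tensor2 K A)"
  shows "hom_bracket K A (\<beta> \<circ> \<mu>) (\<beta> \<circ> \<alpha>) a r = tensor_map K A A \<beta> \<beta> (hom_bracket K A \<mu> \<alpha> a r)"
  unfolding hom_bracket_def
  by (rule tensor_lift_compose[OF A_module A_module T2_module T2_module
        hom_bracket_summand_bilinear[OF a] beta2_linear _ r])
     (simp add: linear_map_minus[OF T2_module T2_module beta2_linear]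
        tensor_map_pure[OF A_module A_module A_module A_module beta_linear beta_linear] closed a)

lemma ahybe_twist:
  assumes r: "r \<in> carrier (tensor2 K A)"
  shows "ahybe K A (\<beta> \<circ> \<mu>) (\<beta> \<circ> \<alpha>) r =
    tensor_map K (tensor2 K A) A (tensor_map K A A \<beta> \<beta>) \<beta> (ahybe K A \<mu> \<alpha> r)"
proof -
  interpret T3: module K "tensor3 K A" by (rule T3_module)
  show ?thesis
    unfolding ahybe_def ahybe_summand_def[symmetric]
  \<comment> \<open>Naturality is applied once for the outer sum and once for the inner, which
    leaves an identity between summands.\<close>
  proof (rule tensor_lift_compose[OF A_module A_module T3_module T3_module
        ahybe_inner_bilinear[OF r] beta3_linear _ r],
      rule tensor_lift_compose[OF A_module A_module T3_module T3_module
        ahybe_summand_bilinear beta3_linear _ r])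
    fix ui vi uj vj
    assume "ui \<in> carrier A" "vi \<in> carrier A" "uj \<in> carrier A" "vj \<in> carrier A"
    then show "pure3 K A ((\<beta> \<circ> \<mu>) (pure2 K A ui uj)) ((\<beta> \<circ> \<alpha>) vj) ((\<beta> \<circ> \<alpha>) vi)
        \<ominus>\<^bsub>tensor3 K A\<^esub> pure3 K A ((\<beta> \<circ> \<alpha>) ui) ((\<beta> \<circ> \<mu>) (pure2 K A vi uj)) ((\<beta> \<circ> \<alpha>) vj)
        \<oplus>\<^bsub>tensor3 K A\<^esub> pure3 K A ((\<beta> \<circ> \<alpha>) uj) ((\<beta> \<circ> \<alpha>) ui) ((\<beta> \<circ> \<mu>) (pure2 K A vi vj)) =
      tensor_map K (tensor2 K A) A (tensor_map K A A \<beta> \<beta>) \<beta> (ahybe_summand ui vi uj vj)"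
      by (simp add: ahybe_summand_def linear_mapD(2)[OF beta3_linear]
          linear_map_minus[OF T3_module T3_module beta3_linear]
          tensor_map_pure[OF A_module A_module A_module A_module beta_linear beta_linear]
          tensor_map_pure[OF T2_module A_module T2_module A_module beta2_linear beta_linear] closed)
  qed
qed

end

end

text \<open>The coboundary condition holds because \<Delta>\<beta> is \<beta> \<otimes> \<beta>
  after \<Delta>, which is the twisted bracket. The Yang-Baxter equation holds because a linear map
  sends A(r) = 0 to 0.\<close>

lemma (in quasi_triangular_eps_hom_bialgebra) quasi_triangular_twist:
  assumes beta_linear: "linear_map K A A \<beta>"
    and beta_alpha: "\<And>a. \<beta> (\<alpha> a) = \<alpha> (\<beta> a)"
    and beta_mu: "\<And>t. t \<in> carrier (tensor2 K A) \<Longrightarrow> \<beta> (\<mu> t) = \<mu> (tensor_map K A A \<beta> \<beta> t)"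
    and beta_Delta: "\<And>a. a \<in> carrier A \<Longrightarrow> tensor_map K A A \<beta> \<beta> (\<Delta> a) = \<Delta> (\<beta> a)"
    and beta_r: "tensor_map K A A \<beta> \<beta> r = r"
  shows "quasi_triangular_eps_hom_bialgebra K A (\<beta> \<circ> \<mu>) (\<Delta> \<circ> \<beta>) (\<beta> \<circ> \<alpha>) r"
proof (intro quasi_triangular_eps_hom_bialgebra.intro coboundary_eps_hom_bialgebra.intro
    quasi_triangular_eps_hom_bialgebra_axioms.intro coboundary_eps_hom_bialgebra_axioms.intro)
  note beta = beta_linear beta_alpha beta_mu beta_Delta
  show "eps_hom_bialgebra K A (\<beta> \<circ> \<mu>) (\<Delta> \<circ> \<beta>) (\<beta> \<circ> \<alpha>)"
    by (rule eps_hom_bialgebra_twist[OF beta])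
  show "r \<in> carrier (tensor2 K A)" by (rule r_closed)
  show "tensor_map K A A (\<beta> \<circ> \<alpha>) (\<beta> \<circ> \<alpha>) r = r"
    using tensor_map_compose[OF A_module A_module A_module A_module A_module A_module
        alpha_linear alpha_linear beta_linear beta_linear r_closed]
    by (simp add: r_invariant beta_r)
  show "(\<Delta> \<circ> \<beta>) a = hom_bracket K A (\<beta> \<circ> \<mu>) (\<beta> \<circ> \<alpha>) a r" if "a \<in> carrier A" for a
    using hom_bracket_twist[OF beta that r_closed] that
    by (simp add: Delta_coboundary[symmetric] beta_Delta)
  show "ahybe K A (\<beta> \<circ> \<mu>) (\<beta> \<circ> \<alpha>) r = \<zero>\<^bsub>tensor3 K A\<^esub>"
    using linear_map_zero[OF T3_module T3_module tensor_map_linear[OF T2_module A_module T2_module A_module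
          tensor_map_linear[OF A_module A_module A_module A_module beta_linear beta_linear] beta_linear]]
    by (simp only: ahybe_twist[OF beta r_closed] ahybe_zero)
qed

section \<open>Twisting by powers of \<alpha>\<close>

theorem corollary5p8:
  fixes K :: "('k, 'm) ring_scheme" and A :: "('k, 'a, 'p) module_scheme"
    and \<mu> :: "('a \<times> 'a \<Rightarrow> 'k) set \<Rightarrow> 'a" and \<Delta> :: "'a \<Rightarrow> ('a \<times> 'a \<Rightarrow> 'k) set"
    and \<alpha> :: "'a \<Rightarrow> 'a" and r :: "('a \<times> 'a \<Rightarrow> 'k) set" and n :: nat
  assumes "quasi_triangular_eps_hom_bialgebra K A \<mu> \<Delta> \<alpha> r"
  shows "quasi_triangular_eps_hom_bialgebra K A
    ((\<alpha> ^^ (2 ^ n - 1)) \<circ> \<mu>) (\<Delta> \<circ> (\<alpha> ^^ (2 ^ n - 1))) (\<alpha> ^^ (2 ^ n)) r"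
proof -
  interpret quasi_triangular_eps_hom_bialgebra K A \<mu> \<Delta> \<alpha> r by fact
  note alpha2_closed =
    linear_mapD(1)[OF tensor_map_linear[OF A_module A_module A_module A_module alpha_linear alpha_linear]]
  note pow = tensor_map_funpow[OF A_module alpha_linear]
  \<comment> \<open>Multiplicativity of \<alpha> holds on the carrier only; the induction for \<mu>
    below uses it at iterated tensors.\<close>
  have iter_closed: "(tensor_map K A A \<alpha> \<alpha> ^^ m) t \<in> carrier (tensor2 K A)"
    if "t \<in> carrier (tensor2 K A)" for m t
    using that by (induction m) (auto intro: alpha2_closed)
  \<comment> \<open>Any exponent \<open>m\<close> works. Its twisting map is the power of \<alpha>
    with exponent \<open>m + 1\<close>.\<close>
  have "quasi_triangular_eps_hom_bialgebra K A
    ((\<alpha> ^^ m) \<circ> \<mu>) (\<Delta> \<circ> (\<alpha> ^^ m)) ((\<alpha> ^^ m) \<circ> \<alpha>) r" for m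
  proof (rule quasi_triangular_twist)
    show "linear_map K A A (\<alpha> ^^ m)" by (rule linear_map_funpow[OF alpha_linear])
    show "(\<alpha> ^^ m) (\<alpha> a) = \<alpha> ((\<alpha> ^^ m) a)" for a by (simp add: funpow_swap1)
    show "(\<alpha> ^^ m) (\<mu> t) = \<mu> (tensor_map K A A (\<alpha> ^^ m) (\<alpha> ^^ m) t)"
      if "t \<in> carrier (tensor2 K A)" for t
      unfolding pow[OF that]
      by (induction m) (simp_all add: mu_multiplicative iter_closed that)
    show "tensor_map K A A (\<alpha> ^^ m) (\<alpha> ^^ m) (\<Delta> a) = \<Delta> ((\<alpha> ^^ m) a)" if "a \<in> carrier A" for a
      unfolding pow[OF linear_mapD(1)[OF Delta_linear that]]
      by (induction m)
         (simp_all add: Delta_comultiplicative that linear_mapD(1)[OF linear_map_funpow[OF alpha_linear]])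
    show "tensor_map K A A (\<alpha> ^^ m) (\<alpha> ^^ m) r = r"
      unfolding pow[OF r_closed] by (induction m) (simp_all add: r_invariant)
  qed
  \<comment> \<open>As \<open>2 ^ n\<close> is positive, the natural subtraction does not truncate
    and \<open>Suc (2 ^ n - 1)\<close> is \<open>2 ^ n\<close>. Removing \<open>funpow.simps\<close>
    keeps the merged power from being unfolded again.\<close>
  from this[of "2 ^ n - 1"] show ?thesis
    by (simp add: funpow_Suc_right[symmetric] del: funpow.simps)
qed

end
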